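(* Let $d\ge2$, $n\ge1$, and let $F=I-H:\mathbb{C}^n\to\mathbb{C}^n$ with $H_i(X)=\sum_{|\alpha|=d}\frac{H_{i,\alpha}}{\alpha!}X^\alpha$ for complex coefficients $H_{i,\alpha}$ ($JH$ may or may not be nilpotent). Let $L:=\max_{i,\alpha}|H_{i,\alpha}|$, and let $g_{i,\alpha}$ be the coefficient of $X^\alpha$ in the $i$-th component of the power series inverse $F^{-1}$. Then for all $i\in[n]$, $k\ge1$ and all $\alpha$ with $|\alpha|=(d-1)k+1$, $$|g_{i,\alpha}|\le\frac{1}{(d!)^k}\frac{1}{(d-1)k+1}\binom{dk}{k}n^{k-1}\frac{|\alpha|!}{\alpha!}L^k. \qquad (1)$$ This bound is sharp: there exists such an $F$ for which equality holds in (1) for all $i$ and $\alpha$. If in addition $(JH)^p=0$ for some $p\in\mathbb{N}$, then for every function $\phi$ in $\mathrm{span}\{\mathbf{1}_{\mathcal{S}}:\mathcal{S}\text{ a length-}p\text{ shuffle class in }\mathcal{C}_k^{(d)}\}$, $$|g_{i,\alpha}|\le\frac{1}{(d!)^k}\frac{1}{(d-1)k+1}\binom{dk}{k}n^{k-1}\frac{|\alpha|!}{\alpha!}L^k\cdot\|\phi-\mathbf{1}\|_1,$$ and in particular there are constants $C,c\in(0,\infty)$ depending only on $d$ and $p$ such that, for all sufficiently large $k$, $$|g_{i,\alpha}|\le\frac{1}{(d!)^k}\frac{1}{(d-1)k+1}\binom{dk}{k}n^{k-1}\frac{|\alpha|!}{\alpha!}L^k\cdot Ce^{-ck}.$$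
   Context: Multi-index notation: $|\alpha|=\sum_j\alpha_j$, $\alpha!=\prod_j\alpha_j!$, $X^\alpha=\prod_jX_j^{\alpha_j}$. $I$ is the identity map and $JH$ the Jacobian matrix of $H$. A $d$-Catalan tree is a rooted planar tree in which each vertex has $0$ or $d$ children; $\mathcal{C}_k^{(d)}$ is the set of those with $k$ internal vertices. For a path $(v_0,\dots,v_p)$ ($v_i$ a child of $v_{i-1}$) in $T\in\mathcal{C}_k^{(d)}$, the shuffle class $\mathrm{Sh}(T;v_0,\dots,v_p)$ is the set of trees obtained from $T$ by rearranging the $(d-1)p$ subtrees subtended by the siblings of $v_1,\dots,v_p$ among those sibling positions; a length-$p$ shuffle class is any such set, $\mathbf{1}_{\mathcal{S}}$ its indicator. $\|f\|_1:=\frac{1}{\#\mathcal{C}_k^{(d)}}\sum_{T\in\mathcal{C}_k^{(d)}}|f(T)|$ and $\mathbf{1}$ is the constant function $1$. *)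

theory Defs
  imports "HOL-Analysis.Analysis" "HOL-Combinatorics.Permutations"
begin

text \<open>Multi-indices are functions nat => nat vanishing from n on; a (formal) power
series in n variables is its coefficient function on such multi-indices.\<close>

definition mi :: "nat \<Rightarrow> (nat \<Rightarrow> nat) set" where
  "mi n = {\<alpha>. \<forall>j\<ge>n. \<alpha> j = 0}"

definition mdeg :: "nat \<Rightarrow> (nat \<Rightarrow> nat) \<Rightarrow> nat" where
  "mdeg n \<alpha> = (\<Sum>j<n. \<alpha> j)"

definition mfact :: "nat \<Rightarrow> (nat \<Rightarrow> nat) \<Rightarrow> nat" where
  "mfact n \<alpha> = (\<Prod>j<n. fact (\<alpha> j))"

definition below :: "nat \<Rightarrow> (nat \<Rightarrow> nat) \<Rightarrow> (nat \<Rightarrow> nat) set" where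
  "below n \<alpha> = {\<beta>. \<forall>j. \<beta> j \<le> \<alpha> j \<and> (n \<le> j \<longrightarrow> \<beta> j = 0)}"

type_synonym fps_n = "(nat \<Rightarrow> nat) \<Rightarrow> complex"

definition smul :: "nat \<Rightarrow> fps_n \<Rightarrow> fps_n \<Rightarrow> fps_n" where
  "smul n f g = (\<lambda>\<alpha>. \<Sum>\<beta>\<in>below n \<alpha>. f \<beta> * g (\<lambda>j. \<alpha> j - \<beta> j))"

definition sone :: fps_n where
  "sone = (\<lambda>\<alpha>. if \<alpha> = (\<lambda>_. 0) then 1 else 0)"

definition spow :: "nat \<Rightarrow> fps_n \<Rightarrow> nat \<Rightarrow> fps_n" where
  "spow n f m = (smul n f ^^ m) sone"

definition smono :: "nat \<Rightarrow> (nat \<Rightarrow> fps_n) \<Rightarrow> (nat \<Rightarrow> nat) \<Rightarrow> fps_n" where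
  "smono n G \<beta> = foldr (\<lambda>j acc. smul n (spow n (G j) (\<beta> j)) acc) [0..<n] sone"

definition unitv :: "nat \<Rightarrow> nat \<Rightarrow> nat" where
  "unitv i = (\<lambda>j. if j = i then 1 else 0)"

definition Hpoly :: "nat \<Rightarrow> nat \<Rightarrow> (nat \<Rightarrow> (nat \<Rightarrow> nat) \<Rightarrow> complex) \<Rightarrow> nat \<Rightarrow> fps_n" where
  "Hpoly n d Hc i = (\<lambda>\<alpha>. if \<alpha> \<in> mi n \<and> mdeg n \<alpha> = d
                          then Hc i \<alpha> / of_nat (mfact n \<alpha>) else 0)"

definition Hcomp :: "nat \<Rightarrow> nat \<Rightarrow> (nat \<Rightarrow> (nat \<Rightarrow> nat) \<Rightarrow> complex) \<Rightarrow> (nat \<Rightarrow> fps_n) \<Rightarrow> nat \<Rightarrow> fps_n" where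
  "Hcomp n d Hc G i = (\<lambda>\<alpha>. \<Sum>\<beta>\<in>{\<beta>\<in>mi n. mdeg n \<beta> = d}.
                          Hc i \<beta> / of_nat (mfact n \<beta>) * smono n G \<beta> \<alpha>)"

text \<open>g is the power series inverse of F = I - H: G(0) = 0 and F(G(X)) = G - H(G) = X.
  (g i alpha = coefficient of X^alpha in the i-th component.)\<close>
definition is_inverse :: "nat \<Rightarrow> nat \<Rightarrow> (nat \<Rightarrow> (nat \<Rightarrow> nat) \<Rightarrow> complex) \<Rightarrow> (nat \<Rightarrow> fps_n) \<Rightarrow> bool" where
  "is_inverse n d Hc g \<longleftrightarrow>
     (\<forall>i<n. g i (\<lambda>_. 0) = 0) \<and>
     (\<forall>i<n. \<forall>\<alpha>\<in>mi n. g i \<alpha> - Hcomp n d Hc g i \<alpha> = (if \<alpha> = unitv i then 1 else 0))"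

definition sderiv :: "nat \<Rightarrow> fps_n \<Rightarrow> fps_n" where
  "sderiv j f = (\<lambda>\<alpha>. of_nat (\<alpha> j + 1) * f (\<alpha>(j := \<alpha> j + 1)))"

definition JH :: "nat \<Rightarrow> nat \<Rightarrow> (nat \<Rightarrow> (nat \<Rightarrow> nat) \<Rightarrow> complex) \<Rightarrow> nat \<Rightarrow> nat \<Rightarrow> fps_n" where
  "JH n d Hc i j = sderiv j (Hpoly n d Hc i)"

definition matmul :: "nat \<Rightarrow> (nat \<Rightarrow> nat \<Rightarrow> fps_n) \<Rightarrow> (nat \<Rightarrow> nat \<Rightarrow> fps_n) \<Rightarrow> nat \<Rightarrow> nat \<Rightarrow> fps_n" where
  "matmul n A B = (\<lambda>i j \<alpha>. \<Sum>l<n. smul n (A i l) (B l j) \<alpha>)"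

definition matid :: "nat \<Rightarrow> nat \<Rightarrow> fps_n" where
  "matid i j = (if i = j then sone else (\<lambda>_. 0))"

definition matpow :: "nat \<Rightarrow> (nat \<Rightarrow> nat \<Rightarrow> fps_n) \<Rightarrow> nat \<Rightarrow> nat \<Rightarrow> nat \<Rightarrow> fps_n" where
  "matpow n A p = (matmul n A ^^ p) matid"

definition JH_nilp :: "nat \<Rightarrow> nat \<Rightarrow> (nat \<Rightarrow> (nat \<Rightarrow> nat) \<Rightarrow> complex) \<Rightarrow> nat \<Rightarrow> bool" where
  "JH_nilp n d Hc p \<longleftrightarrow> (\<forall>i<n. \<forall>j<n. \<forall>\<alpha>\<in>mi n. matpow n (JH n d Hc) p i j \<alpha> = 0)"

definition Lmax :: "nat \<Rightarrow> nat \<Rightarrow> (nat \<Rightarrow> (nat \<Rightarrow> nat) \<Rightarrow> complex) \<Rightarrow> real" where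
  "Lmax n d Hc = Max {cmod (Hc i \<beta>) | i \<beta>. i < n \<and> \<beta> \<in> mi n \<and> mdeg n \<beta> = d}"

definition gbound :: "nat \<Rightarrow> nat \<Rightarrow> nat \<Rightarrow> (nat \<Rightarrow> nat) \<Rightarrow> real \<Rightarrow> real" where
  "gbound d n k \<alpha> L =
     1 / (fact d) ^ k * (1 / real ((d - 1) * k + 1)) * real ((d * k) choose k)
     * real n ^ (k - 1) * (fact (mdeg n \<alpha>) / real (mfact n \<alpha>)) * L ^ k"

datatype ptree = Nd "ptree list"

fun internal :: "ptree \<Rightarrow> nat" where
  "internal (Nd ts) = (if ts = [] then 0 else 1 + sum_list (map internal ts))"

fun dcat :: "nat \<Rightarrow> ptree \<Rightarrow> bool" where
  "dcat d (Nd ts) = (ts = [] \<or> (length ts = d \<and> list_all (dcat d) ts))"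

definition catalan :: "nat \<Rightarrow> nat \<Rightarrow> ptree set" where
  "catalan d k = {T. dcat d T \<and> internal T = k}"

text \<open>Vertices are addressed by positions (list of child indices from the root).\<close>
fun ispos :: "ptree \<Rightarrow> nat list \<Rightarrow> bool" where
  "ispos T [] = True"
| "ispos (Nd ts) (c # cs) = (c < length ts \<and> ispos (ts ! c) cs)"

fun subt :: "ptree \<Rightarrow> nat list \<Rightarrow> ptree" where
  "subt T [] = T"
| "subt (Nd ts) (c # cs) = (if c < length ts then subt (ts ! c) cs else Nd [])"

fun repl :: "ptree \<Rightarrow> nat list \<Rightarrow> ptree \<Rightarrow> ptree" where
  "repl T [] S = S"
| "repl (Nd ts) (c # cs) S = (if c < length ts then Nd (ts[c := repl (ts ! c) cs S]) else Nd ts)"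

definition is_internal :: "ptree \<Rightarrow> nat list \<Rightarrow> bool" where
  "is_internal T v \<longleftrightarrow> ispos T v \<and> subt T v \<noteq> Nd []"

text \<open>A path (v_0,...,v_p) with v_i = v_0 @ take i cs, v_i a child of v_{i-1}.\<close>
definition is_path :: "ptree \<Rightarrow> nat list \<Rightarrow> nat list \<Rightarrow> bool" where
  "is_path T v0 cs \<longleftrightarrow> ispos T v0 \<and>
     (\<forall>i<length cs. is_internal T (v0 @ take i cs) \<and>
                    cs ! i < length (case subt T (v0 @ take i cs) of Nd ts \<Rightarrow> ts))"

definition sibpos :: "nat \<Rightarrow> nat list \<Rightarrow> nat list \<Rightarrow> nat list list" where
  "sibpos d v0 cs = concat (map (\<lambda>i. map (\<lambda>j. v0 @ take i cs @ [j])
                                         (filter (\<lambda>j. j \<noteq> cs ! i) [0..<d]))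
                                [0..<length cs])"

definition repl_all :: "ptree \<Rightarrow> (nat list \<times> ptree) list \<Rightarrow> ptree" where
  "repl_all T rs = foldl (\<lambda>T' (q, S). repl T' q S) T rs"

definition shuffle_class :: "nat \<Rightarrow> ptree \<Rightarrow> nat list \<Rightarrow> nat list \<Rightarrow> ptree set" where
  "shuffle_class d T v0 cs =
     (let P = sibpos d v0 cs; N = length P in
      {repl_all T (map (\<lambda>m. (P ! m, subt T (P ! (\<sigma> m)))) [0..<N]) | \<sigma>. \<sigma> permutes {..<N}})"

definition shuffle_classes :: "nat \<Rightarrow> nat \<Rightarrow> nat \<Rightarrow> ptree set set" where
  "shuffle_classes d k p =
     {shuffle_class d T v0 cs | T v0 cs. T \<in> catalan d k \<and> is_path T v0 cs \<and> length cs = p}"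

definition shuffle_span :: "nat \<Rightarrow> nat \<Rightarrow> nat \<Rightarrow> (ptree \<Rightarrow> real) set" where
  "shuffle_span d k p =
     {\<phi>. \<exists>A c. finite A \<and> A \<subseteq> shuffle_classes d k p \<and>
            \<phi> = (\<lambda>T. \<Sum>S\<in>A. c S * indicator S T)}"

definition norm1 :: "nat \<Rightarrow> nat \<Rightarrow> (ptree \<Rightarrow> real) \<Rightarrow> real" where
  "norm1 d k f = (\<Sum>T\<in>catalan d k. \<bar>f T\<bar>) / real (card (catalan d k))"

end

theory Submission
  imports Defs "HOL-Combinatorics.Multiset_Permutations"
begin

text \<open>
  Iterating \<open>G = X + H(G)\<close> with \<open>H\<^sub>i(X) = (1/d!) \<Sum>\<^sub>j H\<^sub>i\<^sub>,\<^sub>j X\<^sub>j\<^sub>1 \<cdots> X\<^sub>j\<^sub>d\<close> expands the degree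
  \<open>(d-1)k+1\<close> part of \<open>G\<^sub>i\<close> as \<open>(d!)\<^sup>-\<^sup>k\<close> times a sum of weights over the \<open>d\<close>-Catalan trees with \<open>k\<close>
  internal vertices.  The weight of every tree is majorised by the weight for the constant
  coefficients \<open>L\<close>, which is \<open>n\<^bsup>k-1\<^esup> L\<^sup>k (X\<^sub>1 + \<cdots> + X\<^sub>n)\<^bsup>(d-1)k+1\<^esup>\<close>; this gives the bound and its
  sharpness.

  Polarising \<open>(JH)\<^sup>p = 0\<close> shows that the weights of the trees in a length-\<open>p\<close> shuffle class sum to
  zero, so \<open>\<phi>\<close> can be subtracted for free.  If a tree contains the left comb with \<open>p\<close> internal
  vertices as a fringe subtree then all shuffled subtrees are leaves and its shuffle class is a
  singleton; only the trees avoiding this comb survive.  Their generating function satisfies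
  \<open>A = 1 + x A\<^sup>d - x\<^sup>p\<close>, hence it converges slightly beyond the radius
  \<open>\<rho> = (d-1)\<^bsup>d-1\<^esup>/d\<^sup>d\<close> of the Catalan series, while the number of all trees is at least
  \<open>\<rho>\<^bsup>-k\<^esup>\<close> up to a polynomial factor.
\<close>

section \<open>Power series indexed by multisets of variables\<close>

text \<open>Sums over multi-indices normalised by \<alpha>! are traded for sums over ordered index
  words, because planar trees see ordered words. The expansion runs over forests: opening a root
  turns one tree into \<open>d\<close> trees, and one recursion then yields both the number of trees
  and the coefficients. The obstacle in the nilpotent case is that \<open>(JH)^p = 0\<close> only
  makes coefficients of monomials vanish, that is, sums over all orderings of an index word, whereas
  in a tree every sibling slot along a path carries its own series. Summing over all rearrangements
  of the sibling subtrees restores exactly the missing symmetry, so a whole shuffle class is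
  annihilated although a single tree need not be. The exponential gain is delicate because at the
  radius \<rho> the map \<open>z -> 1 + \<rho> z^d\<close> is tangent to the diagonal at its fixed
  point, which leaves no room beyond \<rho>. Forbidding one tree with \<open>p\<close> internal
  vertices lowers the map by \<open>x^p\<close> and opens a gap. Finite truncated sums and a barrier
  at the fixed point take the place of analytic arguments.\<close>

lemma finite_subseteq_mset [simp]: "finite {B. B \<subseteq># A}"
proof (induction A)
  case (add x A)
  have "{B. B \<subseteq># add_mset x A} \<subseteq> {B. B \<subseteq># A} \<union> add_mset x ` {B. B \<subseteq># A}"
  proof
    fix B assume B: "B \<in> {B. B \<subseteq># add_mset x A}"
    show "B \<in> {B. B \<subseteq># A} \<union> add_mset x ` {B. B \<subseteq># A}"
    proof (cases "x \<in># B")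
      case True
      then obtain C where "B = add_mset x C" by (metis insert_DiffM)
      then show ?thesis using B by auto
    next
      case False
      then have "count B a \<le> count A a" for a
        using B by (cases "a = x") (auto simp: subseteq_mset_def not_in_iff dest: spec[of _ a])
      then show ?thesis by (simp add: subseteq_mset_def)
    qed
  qed
  then show ?case using add by (meson finite_UnI finite_imageI finite_subset)
qed simp

text \<open>A type of its own, so that convolution can become a ring multiplication. A multiset
  stands for a monomial, and having finitely many submultisets it makes every convolution a finite
  sum.\<close>

typedef mps = "UNIV :: (nat multiset \<Rightarrow> complex) set"
  morphisms mcoeff Mps ..

setup_lifting type_definition_mps

lemma mcoeff_Mps [simp]: "mcoeff (Mps f) = f"
  by (simp add: Mps_inverse)

lemma mps_eqI: "(\<And>A. mcoeff f A = mcoeff g A) \<Longrightarrow> f = g"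
  by (metis ext mcoeff_inject)

lemma diff_diff_cancel_mset: "B \<subseteq># A \<Longrightarrow> A - (A - B) = B"
  by (auto simp: multiset_eq_iff subseteq_mset_def)

lemma sum_splits_commute:
  fixes f g :: "nat multiset \<Rightarrow> complex"
  shows "(\<Sum>B\<in>{B. B \<subseteq># A}. f B * g (A - B)) = (\<Sum>B\<in>{B. B \<subseteq># A}. g B * f (A - B))"
  by (rule sum.reindex_bij_witness[where i = "\<lambda>B. A - B" and j = "\<lambda>B. A - B"])
    (auto simp: diff_diff_cancel_mset mult.commute)

text \<open>Both sides enumerate the ordered splittings of \<open>A\<close> into three parts; the
  bijection keeps the first part \<open>C\<close> and exchanges \<open>B\<close> for the middle part
  \<open>B - C\<close>.\<close>

lemma sum_splits_assoc:
  fixes f g h :: "nat multiset \<Rightarrow> complex"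
  shows "(\<Sum>B\<in>{B. B \<subseteq># A}. (\<Sum>C\<in>{C. C \<subseteq># B}. f C * g (B - C)) * h (A - B))
       = (\<Sum>C\<in>{C. C \<subseteq># A}. f C * (\<Sum>D\<in>{D. D \<subseteq># A - C}. g D * h (A - C - D)))"
proof -
  have "(\<Sum>B\<in>{B. B \<subseteq># A}. (\<Sum>C\<in>{C. C \<subseteq># B}. f C * g (B - C)) * h (A - B))
    = (\<Sum>(B, C)\<in>(SIGMA B:{B. B \<subseteq># A}. {C. C \<subseteq># B}). f C * g (B - C) * h (A - B))"
    by (simp add: sum_distrib_right sum.Sigma)
  also have "\<dots> = (\<Sum>(C, D)\<in>(SIGMA C:{C. C \<subseteq># A}. {D. D \<subseteq># A - C}). f C * (g D * h (A - C - D)))"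
    by (rule sum.reindex_bij_witness[where i = "\<lambda>(C, D). (C + D, C)" and j = "\<lambda>(B, C). (C, B - C)"])
      (auto simp: subset_mset.le_diff_conv2 add.commute mult.assoc diff_diff_add_mset
        intro: subset_mset.order_trans)
  also have "\<dots> = (\<Sum>C\<in>{C. C \<subseteq># A}. f C * (\<Sum>D\<in>{D. D \<subseteq># A - C}. g D * h (A - C - D)))"
    by (simp add: sum_distrib_left sum.Sigma)
  finally show ?thesis .
qed

instantiation mps :: comm_ring_1
begin

lift_definition zero_mps :: mps is "\<lambda>_. 0" .
lift_definition one_mps :: mps is "\<lambda>A. if A = {#} then 1 else 0" .
lift_definition plus_mps :: "mps \<Rightarrow> mps \<Rightarrow> mps" is "\<lambda>f g A. f A + g A" .
lift_definition minus_mps :: "mps \<Rightarrow> mps \<Rightarrow> mps" is "\<lambda>f g A. f A - g A" .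
lift_definition uminus_mps :: "mps \<Rightarrow> mps" is "\<lambda>f A. - f A" .
lift_definition times_mps :: "mps \<Rightarrow> mps \<Rightarrow> mps" is
  "\<lambda>f g A. \<Sum>B\<in>{B. B \<subseteq># A}. f B * g (A - B)" .

instance
proof
  fix a b c :: mps
  show "a * b * c = a * (b * c)" by transfer (rule ext, rule sum_splits_assoc)
  show "a * b = b * a" by transfer (rule ext, rule sum_splits_commute)
  show "1 * a = a"
  proof (transfer, rule ext)
    fix a :: "nat multiset \<Rightarrow> complex" and A
    have "(\<Sum>B\<in>{B. B \<subseteq># A}. (if B = {#} then 1 else 0) * a (A - B))
      = (\<Sum>B\<in>{{#}}. (if B = {#} then 1 else 0) * a (A - B))"
      by (rule sum.mono_neutral_right) auto
    then show "(\<Sum>B\<in>{B. B \<subseteq># A}. (if B = {#} then 1 else 0) * a (A - B)) = a A" by simp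
  qed
  show "(a + b) * c = a * c + b * c"
    by transfer (auto simp: algebra_simps sum.distrib)
  show "(0::mps) \<noteq> 1" by transfer (metis zero_neq_one)
qed (transfer; auto simp: algebra_simps)+

end

lemma mcoeff_0 [simp]: "mcoeff 0 A = 0"
  and mcoeff_1: "mcoeff 1 A = (if A = {#} then 1 else 0)"
  and mcoeff_add [simp]: "mcoeff (f + g) A = mcoeff f A + mcoeff g A"
  and mcoeff_diff [simp]: "mcoeff (f - g) A = mcoeff f A - mcoeff g A"
  and mcoeff_mult: "mcoeff (f * g) A = (\<Sum>B\<in>{B. B \<subseteq># A}. mcoeff f B * mcoeff g (A - B))"
  by (transfer; simp)+

lemma mcoeff_sum [simp]: "mcoeff (sum f I) A = (\<Sum>i\<in>I. mcoeff (f i) A)"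
  by (induction I rule: infinite_finite_induct) auto

section \<open>Constants, variables and the order of a series\<close>

lift_definition cst :: "complex \<Rightarrow> mps" is "\<lambda>c A. if A = {#} then c else 0" .
lift_definition Var :: "nat \<Rightarrow> mps" is "\<lambda>i A. if A = {#i#} then 1 else 0" .

lemma mcoeff_Var: "mcoeff (Var i) A = (if A = {#i#} then 1 else 0)"
  by transfer simp

lemma mcoeff_cst_mult [simp]: "mcoeff (cst c * f) A = c * mcoeff f A"
proof -
  have "mcoeff (cst c * f) A = (\<Sum>B\<in>{{#}}. mcoeff (cst c) B * mcoeff f (A - B))"
    unfolding mcoeff_mult by (rule sum.mono_neutral_right) (auto simp: cst.rep_eq)
  then show ?thesis by (simp add: cst.rep_eq)
qed

lemma cst_0 [simp]: "cst 0 = 0"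
  and cst_1 [simp]: "cst 1 = 1"
  and cst_add: "cst (a + b) = cst a + cst b"
  by (transfer; auto)+

lemma cst_mult: "cst (a * b) = cst a * cst b"
  by (rule mps_eqI) (simp add: cst.rep_eq)

lemma cst_sum: "cst (sum f I) = (\<Sum>i\<in>I. cst (f i))"
  by (induction I rule: infinite_finite_induct) (auto simp: cst_add)

lemma cst_of_nat: "cst (of_nat k) = of_nat k"
  by (induction k) (auto simp: cst_add)

lemma mcoeff_Var_mult: "mcoeff (Var i * f) A = (if i \<in># A then mcoeff f (A - {#i#}) else 0)"
proof -
  have "mcoeff (Var i * f) A = (\<Sum>B\<in>{B. B \<subseteq># A} \<inter> {{#i#}}. mcoeff (Var i) B * mcoeff f (A - B))"
    unfolding mcoeff_mult by (rule sum.mono_neutral_right) (auto simp: mcoeff_Var)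
  also have "{B. B \<subseteq># A} \<inter> {{#i#}} = (if i \<in># A then {{#i#}} else {})" by auto
  finally show ?thesis by (simp add: mcoeff_Var)
qed

lemma mcoeff_prod_list_Var: "mcoeff (prod_list (map Var js)) A = (if mset js = A then 1 else 0)"
  by (induction js arbitrary: A) (auto simp: mcoeff_1 mcoeff_Var_mult dest: insert_DiffM)

text \<open>The filtration by total degree. It decides which products cannot reach a given degree,
  and it measures the convergence of the iterates in the existence proof.\<close>

definition mord :: "nat \<Rightarrow> mps \<Rightarrow> bool" where
  "mord m f \<longleftrightarrow> (\<forall>A. size A < m \<longrightarrow> mcoeff f A = 0)"

lemma mord_0 [simp]: "mord m 0" and mord_zero [simp]: "mord 0 f"
  and mord_add: "mord m f \<Longrightarrow> mord m g \<Longrightarrow> mord m (f + g)"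
  and mord_diff: "mord m f \<Longrightarrow> mord m g \<Longrightarrow> mord m (f - g)"
  and mord_cst_mult: "mord m f \<Longrightarrow> mord m (cst c * f)"
  by (auto simp: mord_def)

lemma mord_sum: "(\<And>i. i \<in> I \<Longrightarrow> mord m (f i)) \<Longrightarrow> mord m (sum f I)"
  by (auto simp: mord_def)

lemma mord_mult: "mord a f \<Longrightarrow> mord b g \<Longrightarrow> mord (a + b) (f * g)"
  unfolding mord_def mcoeff_mult
proof (intro allI impI sum.neutral ballI)
  fix A B :: "nat multiset"
  assume *: "\<forall>A. size A < a \<longrightarrow> mcoeff f A = 0" "\<forall>A. size A < b \<longrightarrow> mcoeff g A = 0" "size A < a + b" "B \<in> {B. B \<subseteq># A}"
  then have "size B < a \<or> size (A - B) < b"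
    using size_mset_mono[of B A] by (simp add: size_Diff_submset) linarith
  then show "mcoeff f B * mcoeff g (A - B) = 0" using * by auto
qed

lemma mord_mono: "mord a f \<Longrightarrow> b \<le> a \<Longrightarrow> mord b f"
  by (auto simp: mord_def)

lemma mord_prod_list:
  "(\<And>f. f \<in> set fs \<Longrightarrow> mord 1 f) \<Longrightarrow> mord (length fs) (prod_list fs)"
proof (induction fs)
  case (Cons f fs)
  then show ?case using mord_mult[of 1 f "length fs" "prod_list fs"] by simp
qed simp

lemma mord_eqI: "(\<And>m. mord m (f - g)) \<Longrightarrow> f = g"
  by (rule mps_eqI) (metis eq_iff_diff_eq_0 lessI mcoeff_diff mord_def)

section \<open>Counting forests\<close>

definition tuples :: "'a set \<Rightarrow> nat \<Rightarrow> 'a list set" where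
  "tuples A r = {xs. length xs = r \<and> set xs \<subseteq> A}"

lemma tuples_0 [simp]: "tuples A 0 = {[]}"
  by (auto simp: tuples_def)

lemma tuples_Suc: "tuples A (Suc r) = (\<lambda>(x, xs). x # xs) ` (A \<times> tuples A r)"
  by (auto simp: tuples_def length_Suc_conv image_iff)

lemma finite_tuples [simp]: "finite A \<Longrightarrow> finite (tuples A r)"
  by (induction r) (auto simp: tuples_Suc)

lemma sum_tuples_Suc: "(\<Sum>xs\<in>tuples A (Suc r). f xs) = (\<Sum>x\<in>A. \<Sum>xs\<in>tuples A r. f (x # xs))"
proof -
  have "(\<Sum>xs\<in>tuples A (Suc r). f xs) = (\<Sum>(x, xs)\<in>A \<times> tuples A r. f (x # xs))"
    unfolding tuples_Suc by (subst sum.reindex) (auto simp: inj_on_def case_prod_beta)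
  then show ?thesis by (simp add: sum.cartesian_product)
qed

lemma sum_tuples_append:
  "(\<Sum>xs\<in>tuples A (r + s). f xs) = (\<Sum>ys\<in>tuples A r. \<Sum>zs\<in>tuples A s. f (ys @ zs))"
  by (induction r arbitrary: f) (simp_all add: sum_tuples_Suc)

text \<open>Distributivity of a product of sums. The list \<open>us\<close> supplies one parameter
  per factor; a list of dummy units gives plain powers of a sum.\<close>

lemma sum_tuples_prod_list:
  fixes F :: "'b \<Rightarrow> 'a \<Rightarrow> 'c :: comm_semiring_1"
  shows "(\<Sum>js\<in>tuples A (length us). \<Prod>(j, u)\<leftarrow>zip js us. F u j) = (\<Prod>u\<leftarrow>us. \<Sum>j\<in>A. F u j)"
  by (induction us) (simp_all add: sum_tuples_Suc sum_distrib_left[symmetric] sum_distrib_right[symmetric])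

text \<open>Lists of trees with a joint number of internal vertices: unlike single trees, they are
  closed under deleting the root of the first tree.\<close>

definition forests :: "nat \<Rightarrow> nat \<Rightarrow> nat \<Rightarrow> ptree list set" where
  "forests d r k = {ts. length ts = r \<and> list_all (dcat d) ts \<and> sum_list (map internal ts) = k}"

lemma forests_0: "forests d 0 k = (if k = 0 then {[]} else {})"
  by (auto simp: forests_def)

lemma internal_eq_0_iff [simp]: "internal T = 0 \<longleftrightarrow> T = Nd []"
  by (cases T) auto

lemma forests_Suc_0: "forests d (Suc r) 0 = (#) (Nd []) ` forests d r 0"
  by (auto simp: forests_def length_Suc_conv image_iff)

text \<open>A first tree that is a leaf is dropped; otherwise its root is dissolved into its
  \<open>d\<close> subtrees, at the price of one internal vertex. The list can grow in the second
  case, so inductions go over \<open>k\<close> first and over \<open>r\<close> inside.\<close>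

lemma forests_Suc_Suc:
  assumes "d \<ge> 1"
  shows "forests d (Suc r) (Suc k) = (#) (Nd []) ` forests d r (Suc k)
    \<union> (\<lambda>ws. Nd (take d ws) # drop d ws) ` forests d (d + r) k" (is "?L = ?A \<union> ?B")
proof (intro equalityI subsetI)
  fix ts assume ts: "ts \<in> ?L"
  then obtain us ts' where *: "ts = Nd us # ts'" "length ts' = r"
    by (auto simp: forests_def length_Suc_conv) (metis ptree.exhaust)
  show "ts \<in> ?A \<union> ?B"
  proof (cases "us = []")
    case True
    then show ?thesis using ts * by (auto simp: forests_def)
  next
    case False
    then have "us @ ts' \<in> forests d (d + r) k" "length us = d" using ts * by (auto simp: forests_def)
    then have "ts \<in> ?B" using * by (auto intro!: image_eqI[of _ _ "us @ ts'"])
    then show ?thesis by blast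
  qed
next
  fix ts assume "ts \<in> ?A \<union> ?B"
  then show "ts \<in> ?L"
  proof
    assume "ts \<in> ?B"
    then obtain ws where ws: "ts = Nd (take d ws) # drop d ws" "ws \<in> forests d (d + r) k" by auto
    have "sum_list (map internal ws) = sum_list (map internal (take d ws @ drop d ws))" by simp
    then have "sum_list (map internal ws) = sum_list (map internal (take d ws)) + sum_list (map internal (drop d ws))"
      by (simp only: map_append sum_list_append)
    moreover have "list_all (dcat d) (take d ws @ drop d ws)" using ws by (simp add: forests_def)
    then have "list_all (dcat d) (take d ws)" "list_all (dcat d) (drop d ws)"
      by (simp_all only: list_all_append)
    ultimately show ?thesis using ws assms by (auto simp: forests_def)
  qed (auto simp: forests_def)
qed

lemma finite_forests [simp]:
  assumes "d \<ge> 1"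
  shows "finite (forests d r k)"
proof (induction k arbitrary: r)
  case 0
  show ?case by (induction r) (auto simp: forests_0 forests_Suc_0)
next
  case (Suc k)
  show ?case by (induction r) (auto simp: forests_0 forests_Suc_Suc[OF assms] Suc)
qed

lemma sum_forests_Suc_0: "(\<Sum>ts\<in>forests d (Suc r) 0. f ts) = (\<Sum>ts\<in>forests d r 0. f (Nd [] # ts))"
  unfolding forests_Suc_0 by (subst sum.reindex) auto

lemma sum_forests_Suc_Suc:
  fixes f :: "ptree list \<Rightarrow> 'a :: comm_monoid_add"
  assumes "d \<ge> 1"
  shows "(\<Sum>ts\<in>forests d (Suc r) (Suc k). f ts) = (\<Sum>ts\<in>forests d r (Suc k). f (Nd [] # ts))
    + (\<Sum>ws\<in>forests d (d + r) k. f (Nd (take d ws) # drop d ws))"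
proof -
  have inj: "inj_on (\<lambda>ws. Nd (take d ws) # drop d ws) (forests d (d + r) k)"
    by (auto intro!: inj_onI) (metis append_take_drop_id)
  have ne: "take d ws \<noteq> []" if "ws \<in> forests d (d + r) k" for ws
    using that assms by (auto simp: forests_def)
  have disj: "(#) (Nd []) ` forests d r (Suc k) \<inter> (\<lambda>ws. Nd (take d ws) # drop d ws) ` forests d (d + r) k = {}"
    using ne by fastforce
  show ?thesis unfolding forests_Suc_Suc[OF assms] using assms
    by (subst sum.union_disjoint[OF _ _ disj]) (auto simp: sum.reindex[OF inj] sum.reindex)
qed

text \<open>The Raney numbers \<open>r / (d k + r) * ((d k + r) choose k)\<close>, written without
  division. The forest recursion reduces the claim to an identity between two neighbouring binomial
  coefficients.\<close>

lemma card_forests: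
  assumes "d \<ge> 1"
  shows "(d * k + r) * card (forests d r k) = r * ((d * k + r) choose k)"
proof (induction k arbitrary: r)
  case 0
  have "card (forests d r 0) = 1"
    by (induction r) (simp_all add: forests_0 forests_Suc_0 card_image)
  then show ?case by simp
next
  case (Suc k)
  show ?case
  proof (induction r)
    case 0
    then show ?case by (simp add: forests_0)
  next
    case IH1: (Suc r)
    define M where "M = d * Suc k + r"
    define C0 C1 where "C0 = int (M choose k)" and "C1 = int (M choose Suc k)"
    define T1 T2 where "T1 = int (card (forests d r (Suc k)))" and "T2 = int (card (forests d (d + r) k))"
    have M: "M \<ge> 1" using assms by (auto simp: M_def)
    have "Suc k \<le> d * Suc k" using assms by (metis mult_le_mono1 nat_mult_1)
    then have kM: "k \<le> M" unfolding M_def by linarith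
    have card: "int (card (forests d (Suc r) (Suc k))) = T1 + T2"
      using sum_forests_Suc_Suc[OF assms, of "\<lambda>_. 1::nat" r k] by (simp add: T1_def T2_def)
    have e1: "int M * T1 = int r * C1"
      unfolding T1_def C1_def M_def using IH1 by (metis of_nat_mult)
    have "M * card (forests d (d + r) k) = (d + r) * (M choose k)"
      using Suc[of "d + r"] by (simp add: M_def algebra_simps)
    then have e2: "int M * T2 = (int d + int r) * C0"
      unfolding T2_def C0_def by (metis of_nat_add of_nat_mult)
    have "Suc k * (M choose Suc k) = (M - k) * (M choose k)"
      by (simp only: binomial_absorption binomial_absorb_comp)
    then have e3: "(int k + 1) * C1 = (int M - int k) * C0"
      unfolding C0_def C1_def using kM by (metis of_nat_Suc of_nat_diff of_nat_mult add.commute)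
    have M': "int M = int d * (int k + 1) + int r" by (simp add: M_def algebra_simps)
    \<comment> \<open>The extra factor \<open>M\<close> makes \<open>e1\<close> and
      \<open>e2\<close> applicable; what is left is a polynomial identity modulo \<open>e3\<close>
      and \<open>M'\<close>, after which \<open>M\<close> is cancelled.\<close>
    have "int M * ((int M + 1) * (T1 + T2)) = (int M + 1) * (int M * T1 + int M * T2)" by algebra
    also have "\<dots> = int M * ((int r + 1) * (C0 + C1))"
      unfolding e1 e2 using e3 M' by algebra
    finally have "(int M + 1) * (T1 + T2) = (int r + 1) * (C0 + C1)" using M by simp
    then have "int (Suc M * card (forests d (Suc r) (Suc k))) = int (Suc r * (Suc M choose Suc k))"
      by (simp add: card C0_def C1_def algebra_simps)
    then have "Suc M * card (forests d (Suc r) (Suc k)) = Suc r * (Suc M choose Suc k)"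
      by (simp only: of_nat_eq_iff)
    then show ?case by (simp add: M_def)
  qed
qed

lemma catalan_conv_forests: "(\<lambda>T. [T]) ` catalan d k = forests d 1 k"
  by (auto simp: catalan_def forests_def length_Suc_conv)

lemma sum_catalan_conv_forests: "(\<Sum>T\<in>catalan d k. f T) = (\<Sum>ts\<in>forests d 1 k. f (hd ts))"
  unfolding catalan_conv_forests[symmetric] by (subst sum.reindex) (auto simp: inj_on_def)

lemma finite_catalan [simp]: "d \<ge> 1 \<Longrightarrow> finite (catalan d k)"
  by (rule finite_imageD[of "\<lambda>T. [T]"]) (auto simp: catalan_conv_forests inj_on_def)

text \<open>One-tree forests are counted through \<open>(d k + 1) choose k\<close>; absorption turns
  this into the form with \<open>(d k) choose k\<close> that occurs in
  \<open>gbound\<close>.\<close>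

lemma card_catalan:
  assumes "d \<ge> 1"
  shows "real (card (catalan d k)) = 1 / real ((d - 1) * k + 1) * real ((d * k) choose k)"
proof -
  have "card (catalan d k) = card (forests d 1 k)"
    unfolding catalan_conv_forests[symmetric] by (subst card_image) (auto simp: inj_on_def)
  then have 1: "(d * k + 1) * card (catalan d k) = ((d * k + 1) choose k)"
    using card_forests[OF assms, of k 1] by simp
  have "Suc (d * k) - k = (d - 1) * k + 1"
    using assms by (cases d) (auto simp: algebra_simps)
  moreover have "(Suc (d * k) - k) * (Suc (d * k) choose k) = Suc (d * k) * (d * k choose k)"
    by (simp add: binomial_absorb_comp)
  ultimately have "((d - 1) * k + 1) * ((d * k + 1) choose k) = (d * k + 1) * (d * k choose k)"
    by simp
  then have "(d * k + 1) * (((d - 1) * k + 1) * card (catalan d k)) = (d * k + 1) * (d * k choose k)"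
    unfolding 1[symmetric] by (metis mult.left_commute)
  then have "((d - 1) * k + 1) * card (catalan d k) = (d * k choose k)" by (simp only: mult_cancel1) simp
  then have "real ((d - 1) * k + 1) * real (card (catalan d k)) = real (d * k choose k)"
    by (metis of_nat_mult)
  moreover have "real ((d - 1) * k + 1) \<noteq> 0" by (simp only: of_nat_eq_0_iff)
  ultimately show ?thesis by (metis nonzero_mult_div_cancel_left times_divide_eq_left mult_1)
qed

lemma card_catalan_pos:
  assumes "d \<ge> 1"
  shows "card (catalan d k) > 0"
proof -
  have "k \<le> d * k" using assms by simp
  then have "real (card (catalan d k)) > 0"
    unfolding card_catalan[OF assms] by (intro mult_pos_pos divide_pos_pos; simp only: of_nat_0_less_iff zero_less_one zero_less_binomial_iff)
  then show ?thesis by simp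
qed

section \<open>Trees avoiding a fringe subtree\<close>

text \<open>The \<open>k\<close>-th term is the largest one in the expansion of \<open>(1 + (d-1))\<^bsup>dk\<^esup>\<close>.\<close>

lemma central_term_le:
  assumes "d \<ge> 2"
  shows "real d ^ (d * k) \<le> real (d * k + 1) * (real ((d * k) choose k) * real (d - 1) ^ ((d - 1) * k))"
proof -
  define N where "N = d * k"
  define t where "t j = real (N choose j) * real (d - 1) ^ (N - j)" for j
  \<comment> \<open>The ratio of consecutive terms is \<open>(N - j) / ((j + 1)(d - 1))\<close>,
    which is at least 1 for \<open>j < k\<close> and at most 1 for \<open>k <= j\<close>, as
    \<open>N - k = (d - 1) k\<close>.\<close>
  have step: "real (Suc j) * real (d - 1) * t (Suc j) = real (N - j) * t j" if "j < N" for j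
  proof -
    have "Suc j * (N choose Suc j) = (N - j) * (N choose j)"
      by (simp only: binomial_absorption binomial_absorb_comp)
    then have *: "real (Suc j) * real (N choose Suc j) = real (N - j) * real (N choose j)"
      by (metis of_nat_mult)
    have "real (d - 1) ^ (N - j) = real (d - 1) * real (d - 1) ^ (N - Suc j)"
      using that by (metis Suc_diff_Suc power_Suc)
    then show ?thesis using * unfolding t_def by (metis mult.assoc mult.left_commute)
  qed
  have tpos: "t j \<ge> 0" for j by (simp add: t_def)
  have up: "t j \<le> t (Suc j)" if "j < k" for j
  proof -
    have "k \<le> N" using assms by (simp add: N_def)
    then have jN: "j < N" using that by simp
    have "Suc j * (d - 1) \<le> N - j"
    proof -
      have "Suc j * (d - 1) \<le> k * (d - 1)" using that by (intro mult_right_mono) auto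
      also have "\<dots> = N - k" by (simp add: N_def algebra_simps)
      also have "\<dots> \<le> N - j" using that by simp
      finally show ?thesis .
    qed
    then have "real (Suc j) * real (d - 1) \<le> real (N - j)" by (metis of_nat_le_iff of_nat_mult)
    then have "real (Suc j) * real (d - 1) * t j \<le> real (Suc j) * real (d - 1) * t (Suc j)"
      unfolding step[OF jN] by (rule mult_right_mono) (rule tpos)
    then show ?thesis using assms by simp
  qed
  have down: "t (Suc j) \<le> t j" if "k \<le> j" "j < N" for j
  proof -
    have "N - j \<le> Suc j * (d - 1)"
    proof -
      have "N - j \<le> N - k" using that by simp
      also have "\<dots> = k * (d - 1)" by (simp add: N_def algebra_simps)
      also have "\<dots> \<le> Suc j * (d - 1)" using that by (intro mult_right_mono) auto
      finally show ?thesis .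
    qed
    then have "real (N - j) \<le> real (Suc j) * real (d - 1)" by (metis of_nat_le_iff of_nat_mult)
    then have "real (Suc j) * real (d - 1) * t (Suc j) \<le> real (Suc j) * real (d - 1) * t j"
      unfolding step[OF that(2)] by (rule mult_right_mono) (rule tpos)
    then show ?thesis using assms by simp
  qed
  have "t (k - i) \<le> t k" if "i \<le> k" for i
    using that
  proof (induction i)
    case (Suc i)
    then show ?case using up[of "k - Suc i"] by (simp add: Suc_diff_Suc)
  qed simp
  then have below: "t j \<le> t k" if "j \<le> k" for j using that by (metis diff_diff_cancel diff_le_self)
  have "k + i \<le> N \<Longrightarrow> t (k + i) \<le> t k" for i
  proof (induction i)
    case (Suc i)
    then show ?case using down[of "k + i"] by simp
  qed simp
  then have above: "t j \<le> t k" if "k \<le> j" "j \<le> N" for j using that by (metis le_add_diff_inverse)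
  have "real d ^ N = (1 + real (d - 1)) ^ N" using assms by (simp add: of_nat_diff)
  also have "\<dots> = (\<Sum>j\<le>N. t j)" by (subst binomial_ring) (simp add: t_def)
  also have "\<dots> \<le> real (N + 1) * t k"
    using sum_bounded_above[of "{..N}" t "t k"] below above by (simp add: add.commute) (meson nle_le)
  finally have "real d ^ N \<le> real (N + 1) * t k" .
  moreover have "N - k = (d - 1) * k" by (simp add: N_def diff_mult_distrib)
  ultimately show ?thesis by (simp only: t_def N_def)
qed

fun has_subtree :: "ptree \<Rightarrow> ptree \<Rightarrow> bool" where
  "has_subtree s (Nd ts) \<longleftrightarrow> Nd ts = s \<or> list_ex (has_subtree s) ts"

lemma has_subtree_internal_le: "has_subtree s T \<Longrightarrow> internal s \<le> internal T"
proof (induction s T rule: has_subtree.induct)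
  case (1 s ts)
  show ?case
  proof (cases "Nd ts = s")
    case False
    then obtain t where t: "t \<in> set ts" "has_subtree s t" using 1 by (auto simp: list_ex_iff)
    then have "internal s \<le> internal t" using 1 by blast
    also have "\<dots> \<le> sum_list (map internal ts)" using t by (auto intro: member_le_sum_list)
    finally show ?thesis using t by auto
  qed simp
qed

lemma finite_internal_le [simp]: "d \<ge> 1 \<Longrightarrow> finite {T. dcat d T \<and> internal T \<le> K}"
  by (rule finite_subset[of _ "\<Union>k\<le>K. catalan d k"]) (simp add: catalan_def, blast, simp)

text \<open>One step of the functional equation \<open>z -> x z^d\<close> for weighted counts. Only
  an inclusion is demanded of \<open>B\<close>, so the lemma serves all trees as well as the
  avoiding trees together with \<open>s\<close>.\<close>

lemma sum_power_internal_le: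
  fixes x :: real
  assumes "finite A" "x \<ge> 0" "B \<subseteq> Nd ` tuples A d" "d \<ge> 1"
  shows "(\<Sum>T\<in>B. x ^ internal T) \<le> x * (\<Sum>T\<in>A. x ^ internal T) ^ d"
proof -
  have pw: "x ^ sum_list (map internal us) = (\<Prod>u\<leftarrow>us. x ^ internal u)" for us
    by (induction us) (auto simp: power_add)
  have zp: "(\<Prod>(j, u)\<leftarrow>zip js us. x ^ internal j) = (\<Prod>u\<leftarrow>js. x ^ internal u)"
    if "length js = length us" for js and us :: "unit list"
    using that by (induction js us rule: list_induct2) auto
  have "(\<Sum>T\<in>B. x ^ internal T) \<le> (\<Sum>T\<in>Nd ` tuples A d. x ^ internal T)"
    using assms by (intro sum_mono2) auto
  also have "\<dots> = (\<Sum>us\<in>tuples A d. x ^ internal (Nd us))"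
    by (subst sum.reindex) (auto simp: inj_on_def)
  also have "\<dots> = (\<Sum>us\<in>tuples A d. x * (\<Prod>(j, u)\<leftarrow>zip us (replicate d ()). x ^ internal j))"
  proof (rule sum.cong)
    fix us assume "us \<in> tuples A d"
    then show "x ^ internal (Nd us) = x * (\<Prod>(j, u)\<leftarrow>zip us (replicate d ()). x ^ internal j)"
      using assms by (subst zp) (auto simp: tuples_def pw)
  qed simp
  also have "\<dots> = x * (\<Sum>T\<in>A. x ^ internal T) ^ d"
    using sum_tuples_prod_list[where F = "\<lambda>_ j. x ^ internal j" and A = A and us = "replicate d ()"]
    by (simp add: sum_distrib_left[symmetric])
  finally show ?thesis .
qed

lemma dcat_NdD: "dcat d (Nd us) \<Longrightarrow> us \<noteq> [] \<Longrightarrow> length us = d \<and> (\<forall>u\<in>set us. dcat d u)"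
  by (auto simp: list_all_iff)

lemma internal_child_le: "u \<in> set us \<Longrightarrow> Suc (internal u) \<le> internal (Nd us)"
  by (auto intro: member_le_sum_list)

text \<open>A barrier argument: the truncated weighted sums of the avoiding trees stay below
  \<open>y\<close> even at some \<open>x > \<rho>\<close>. Hence there are at most
  \<open>y / x^k\<close> of them, and comparison with the lower bound for all trees leaves
  \<open>(\<rho>/x)^k\<close> times a polynomial in \<open>k\<close>.\<close>

lemma avoiding_trees_exponentially_few:
  assumes d: "d \<ge> 2" and s: "dcat d s" "s \<noteq> Nd []"
  shows "\<exists>C>0. \<exists>c>0. \<forall>k. real (card {T \<in> catalan d k. \<not> has_subtree s T})
           \<le> C * exp (- c * real k) * real (card (catalan d k))"
proof -
  define p where "p = internal s"
  \<comment> \<open>The double root of \<open>1 + \<rho> z^d = z\<close>: the derivative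
    \<open>\<rho> d y^(d-1)\<close> equals 1.\<close>
  define y where "y = real d / real (d - 1)"
  define \<rho> where "\<rho> = real (d - 1) ^ (d - 1) / real d ^ d"
  define All where "All K = {T. dcat d T \<and> internal T \<le> K}" for K
  define Av where "Av K = {T \<in> All K. \<not> has_subtree s T}" for K
  have d1: "d \<ge> 1" using d by simp
  have [simp]: "finite (All K)" for K
    using d1 by (simp add: All_def)
  then have [simp]: "finite (Av K)" for K
    by (simp add: Av_def)
  have \<rho>: "\<rho> > 0" using d by (simp add: \<rho>_def)
  have y1: "y > 1" using d by (simp add: y_def field_simps)
  have fix_y: "1 + \<rho> * y ^ d = y"
  proof -
    have "\<rho> * y ^ d = real (d - 1) ^ (d - 1) / real (d - 1) ^ d"
      using d by (simp add: \<rho>_def y_def power_divide)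
    also have "\<dots> = 1 / real (d - 1)"
      using d by (cases d) auto
    finally have *: "\<rho> * y ^ d = 1 / real (d - 1)" .
    show ?thesis unfolding * using d by (simp add: y_def field_simps of_nat_diff)
  qed
  have leaf: "(\<Sum>T\<in>insert (Nd []) B. x ^ internal T) = 1 + (\<Sum>T\<in>B. x ^ internal T)"
    if "finite B" "Nd [] \<notin> B" for B and x :: real
    using that by simp
  have stepAll: "(\<Sum>T\<in>All (Suc K). x ^ internal T) \<le> 1 + x * (\<Sum>T\<in>All K. x ^ internal T) ^ d"
    if "x \<ge> 0" for x :: real and K
  proof -
    have "All (Suc K) = insert (Nd []) (All (Suc K) - {Nd []})" by (auto simp: All_def)
    moreover have "All (Suc K) - {Nd []} \<subseteq> Nd ` tuples (All K) d"
    proof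
      fix T assume T: "T \<in> All (Suc K) - {Nd []}"
      obtain us where us: "T = Nd us" by (cases T)
      have T': "us \<noteq> []" "dcat d (Nd us)" "internal (Nd us) \<le> Suc K"
        using T us by (auto simp: All_def simp del: internal.simps dcat.simps)
      have "internal u \<le> K" if "u \<in> set us" for u
        using internal_child_le[OF that] T'(3) by linarith
      then have "us \<in> tuples (All K) d"
        using dcat_NdD[OF T'(2,1)] by (auto simp: All_def tuples_def)
      then show "T \<in> Nd ` tuples (All K) d" using us by blast
    qed
    ultimately show ?thesis
      using sum_power_internal_le[of "All K" x "All (Suc K) - {Nd []}" d] that d1 leaf[of "All (Suc K) - {Nd []}" x]
      by simp
  qed
  \<comment> \<open>The tree \<open>s\<close> is not avoiding, but its proper subtrees are, being
    too small to contain \<open>s\<close>. So \<open>s\<close> is produced by the right-hand side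
    and absent from the sum over \<open>Av\<close>, which accounts for \<open>x ^ p\<close>;
    \<open>p <= Suc K\<close> puts its subtrees below the truncation.\<close>
  have stepAv: "(\<Sum>T\<in>Av (Suc K). x ^ internal T) + x ^ p \<le> 1 + x * (\<Sum>T\<in>Av K. x ^ internal T) ^ d"
    if "x \<ge> 0" "p \<le> Suc K" for x :: real and K
  proof -
    define B where "B = insert s (Av (Suc K) - {Nd []})"
    have ns: "\<not> has_subtree s (Nd [])" using s by simp
    have "Nd [] \<notin> B" "finite B" using s by (auto simp: B_def)
    have sAv: "s \<notin> Av (Suc K)" by (cases s) (simp add: Av_def)
    have "insert (Nd []) B = insert s (Av (Suc K))" using ns by (auto simp: B_def Av_def All_def)
    then have "(\<Sum>T\<in>Av (Suc K). x ^ internal T) + x ^ p = 1 + (\<Sum>T\<in>B. x ^ internal T)"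
      using leaf[of B x] \<open>Nd [] \<notin> B\<close> \<open>finite B\<close> sAv by (simp add: p_def add.commute)
    moreover have "B \<subseteq> Nd ` tuples (Av K) d"
    proof
      fix T assume T: "T \<in> B"
      obtain us where us: "T = Nd us" by (cases T)
      have T': "us \<noteq> []" "dcat d (Nd us)" "internal (Nd us) \<le> Suc K"
        using T us s that(2) by (auto simp: B_def Av_def All_def p_def simp del: internal.simps dcat.simps)
      have "\<not> has_subtree s u" if "u \<in> set us" for u
      proof (cases "T = s")
        case True
        then show ?thesis using internal_child_le[OF that] has_subtree_internal_le[of s u] us by auto
      next
        case False
        then show ?thesis using T us that by (auto simp: B_def Av_def list_ex_iff)
      qed
      moreover have "internal u \<le> K" if "u \<in> set us" for u
        using internal_child_le[OF that] T'(3) by linarith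
      ultimately have "us \<in> tuples (Av K) d"
        using dcat_NdD[OF T'(2,1)] by (auto simp: Av_def All_def tuples_def)
      then show "T \<in> Nd ` tuples (Av K) d" using us by blast
    qed
    ultimately show ?thesis
      using sum_power_internal_le[of "Av K" x B d] that d1 by simp
  qed
  \<comment> \<open>Strictness is essential: a finite sum is continuous in \<open>x\<close>, so a
    strict inequality survives slightly to the right of \<open>\<rho>\<close>.\<close>
  have lt_y: "(\<Sum>T\<in>All K. \<rho> ^ internal T) < y" for K
  proof (induction K)
    case 0
    have "All 0 = {Nd []}" by (auto simp: All_def)
    then show ?case using y1 by simp
  next
    case (Suc K)
    have "(\<Sum>T\<in>All K. \<rho> ^ internal T) ^ d < y ^ d"
      using Suc d \<rho> by (intro power_strict_mono) (auto intro: sum_nonneg)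
    then have "1 + \<rho> * (\<Sum>T\<in>All K. \<rho> ^ internal T) ^ d < 1 + \<rho> * y ^ d" using \<rho> by simp
    then show ?case using stepAll[of \<rho> K] \<rho> fix_y by simp
  qed
  \<comment> \<open>Below size \<open>p\<close> nothing is gained from avoidance, so these
    truncations are handled by continuity. Beyond, moving from \<open>\<rho>\<close> to
    \<open>x\<close> raises the map at \<open>y\<close> by \<open>(x - \<rho>) y^d\<close>, which
    has to be paid for by the gap \<open>\<rho> ^ p\<close>.\<close>
  obtain x where x: "x > \<rho>" "(\<Sum>T\<in>All p. x ^ internal T) < y" "(x - \<rho>) * y ^ d < \<rho> ^ p"
  proof -
    have "((\<lambda>x. \<Sum>T\<in>All p. x ^ internal T) \<longlongrightarrow> (\<Sum>T\<in>All p. \<rho> ^ internal T)) (at_right \<rho>)"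
      by (intro tendsto_intros)
    then have 1: "eventually (\<lambda>x. (\<Sum>T\<in>All p. x ^ internal T) < y) (at_right \<rho>)"
      using lt_y by (rule order_tendstoD)
    have "((\<lambda>x. (x - \<rho>) * y ^ d) \<longlongrightarrow> (\<rho> - \<rho>) * y ^ d) (at_right \<rho>)"
      by (intro tendsto_intros)
    then have 2: "eventually (\<lambda>x. (x - \<rho>) * y ^ d < \<rho> ^ p) (at_right \<rho>)"
      using \<rho> by (intro order_tendstoD) auto
    have 3: "eventually (\<lambda>x. x > \<rho>) (at_right \<rho>)" by (simp add: eventually_at_right_less)
    have "eventually (\<lambda>x. x > \<rho> \<and> (\<Sum>T\<in>All p. x ^ internal T) < y \<and> (x - \<rho>) * y ^ d < \<rho> ^ p) (at_right \<rho>)"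
      using 1 2 3 by eventually_elim auto
    then have "\<exists>x. x > \<rho> \<and> (\<Sum>T\<in>All p. x ^ internal T) < y \<and> (x - \<rho>) * y ^ d < \<rho> ^ p"
      by (intro eventually_happens') auto
    then show ?thesis using that by blast
  qed
  have x0: "x > 0" using x \<rho> by simp
  have le_y: "(\<Sum>T\<in>Av K. x ^ internal T) \<le> y" for K
  proof (induction K)
    case 0
    have "Av 0 \<subseteq> {Nd []}" by (auto simp: Av_def All_def)
    then have "(\<Sum>T\<in>Av 0. x ^ internal T) \<le> (\<Sum>T\<in>{Nd []}. x ^ internal T)"
      using x0 by (intro sum_mono2) auto
    then show ?case using y1 by simp
  next
    case (Suc K)
    show ?case
    proof (cases "p \<le> Suc K")
      case False
      then have "Av (Suc K) \<subseteq> All p" by (auto simp: Av_def All_def)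
      then have "(\<Sum>T\<in>Av (Suc K). x ^ internal T) \<le> (\<Sum>T\<in>All p. x ^ internal T)"
        using x0 by (intro sum_mono2) auto
      then show ?thesis using x by simp
    next
      case True
      have "(\<Sum>T\<in>Av K. x ^ internal T) ^ d \<le> y ^ d"
        using Suc x0 by (intro power_mono) (auto intro: sum_nonneg)
      then have "x * (\<Sum>T\<in>Av K. x ^ internal T) ^ d \<le> x * y ^ d" using x0 by simp
      also have "\<dots> = \<rho> * y ^ d + (x - \<rho>) * y ^ d" by (simp add: algebra_simps)
      finally have "(\<Sum>T\<in>Av (Suc K). x ^ internal T) + x ^ p \<le> y + (x - \<rho>) * y ^ d"
        using stepAv[of x K] x0 True fix_y by linarith
      moreover have "\<rho> ^ p \<le> x ^ p" using x \<rho> by (intro power_mono) auto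
      ultimately show ?thesis using x by linarith
    qed
  qed
  have av: "real (card {T \<in> catalan d k. \<not> has_subtree s T}) * x ^ k \<le> y" for k
  proof -
    have "real (card {T \<in> catalan d k. \<not> has_subtree s T}) * x ^ k
      = (\<Sum>T\<in>{T \<in> catalan d k. \<not> has_subtree s T}. x ^ internal T)"
      by (simp add: catalan_def)
    also have "\<dots> \<le> (\<Sum>T\<in>Av k. x ^ internal T)"
      using x0 by (intro sum_mono2) (simp, auto simp: Av_def All_def catalan_def)
    finally show ?thesis using le_y[of k] by linarith
  qed
  \<comment> \<open>One factor \<open>d k + 1\<close> comes from comparing the largest binomial term
    with the full expansion, the other majorises the denominator \<open>(d - 1) k + 1\<close> of the
    Catalan number.\<close>
  have low: "1 \<le> real (d * k + 1) ^ 2 * (\<rho> ^ k * real (card (catalan d k)))" for k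
  proof -
    have \<rho>k: "\<rho> ^ k = real (d - 1) ^ ((d - 1) * k) / real d ^ (d * k)"
      by (simp add: \<rho>_def power_divide power_mult)
    have "1 \<le> real (d * k + 1) * (real ((d * k) choose k) * real (d - 1) ^ ((d - 1) * k)) / real d ^ (d * k)"
      using central_term_le[OF d, of k] d by simp
    also have "\<dots> = real (d * k + 1) * (\<rho> ^ k * real ((d * k) choose k))"
      by (simp add: \<rho>k)
    also have "real ((d * k) choose k) = real ((d - 1) * k + 1) * real (card (catalan d k))"
      using card_catalan[OF d1, of k] by (metis add_gr_0 less_numeral_extra(1) nonzero_mult_div_cancel_left of_nat_0_less_iff order_less_irrefl times_divide_eq_left times_divide_eq_right mult_1)
    also have "real (d * k + 1) * (\<rho> ^ k * (real ((d - 1) * k + 1) * real (card (catalan d k))))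
      \<le> real (d * k + 1) * (\<rho> ^ k * (real (d * k + 1) * real (card (catalan d k))))"
      using \<rho> by (intro mult_left_mono mult_right_mono) (auto intro: mult_right_mono)
    finally show ?thesis by (simp add: power2_eq_square mult_ac)
  qed
  define q where "q = \<rho> / x"
  \<comment> \<open>Half of the decay rate of \<open>q ^ k\<close>. The other half absorbs the
    polynomial \<open>(d k + 1)^2\<close>; \<open>m\<close> is chosen so that
    \<open>m (d k + 1) <= 1 + c k / 2 <= exp (c k / 2)\<close>.\<close>
  define c where "c = - ln q / 2"
  define m where "m = min 1 (c / (2 * real d))"
  have q: "0 < q" "q < 1" using x \<rho> x0 by (auto simp: q_def)
  have c: "c > 0" using q by (simp add: c_def)
  have m: "m > 0" "m \<le> 1" "m * real d \<le> c / 2" using c d by (auto simp: m_def min_def field_simps)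
  have qk: "q ^ k = exp (- c * real k) * exp (- c * real k)" for k
  proof -
    have "q ^ k = exp (ln q * real k)" using q by (simp add: exp_of_nat2_mult)
    also have "ln q * real k = - c * real k + - c * real k" by (simp add: c_def)
    finally show ?thesis by (simp only: exp_add)
  qed
  have poly: "m ^ 2 * real (d * k + 1) ^ 2 \<le> exp (c * real k)" for k
  proof -
    have "m * real (d * k + 1) = (m * real d) * real k + m" by (simp add: algebra_simps)
    also have "\<dots> \<le> c / 2 * real k + 1" using m by (intro add_mono mult_right_mono) auto
    also have "\<dots> \<le> exp (c * real k / 2)" using exp_ge_add_one_self[of "c * real k / 2"] by linarith
    finally have "(m * real (d * k + 1)) ^ 2 \<le> exp (c * real k / 2) ^ 2"
      using m by (intro power_mono) auto
    also have "\<dots> = exp (c * real k)" by (simp add: exp_double[symmetric])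
    finally show ?thesis by (simp add: power_mult_distrib)
  qed
  have "real (card {T \<in> catalan d k. \<not> has_subtree s T})
     \<le> y / m ^ 2 * exp (- c * real k) * real (card (catalan d k))" for k
  proof -
    let ?a = "real (card {T \<in> catalan d k. \<not> has_subtree s T})" and ?c = "real (card (catalan d k))"
    have "?a \<le> y / x ^ k" using av[of k] x0 by (simp add: field_simps)
    also have "\<dots> \<le> y / x ^ k * (real (d * k + 1) ^ 2 * (\<rho> ^ k * ?c))"
      using mult_left_mono[OF low[of k], of "y / x ^ k"] x0 y1 by simp
    also have "\<dots> = y * (q ^ k * ?c) * real (d * k + 1) ^ 2" by (simp add: q_def power_divide)
    also have "\<dots> \<le> y * (q ^ k * ?c) * (exp (c * real k) / m ^ 2)"
      using poly[of k] m q y1 by (intro mult_left_mono) (auto simp: field_simps)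
    also have "\<dots> = y / m ^ 2 * exp (- c * real k) * ?c * (exp (- c * real k) * exp (c * real k))"
      unfolding qk by simp
    also have "exp (- c * real k) * exp (c * real k) = 1" by (simp flip: exp_add)
    finally show ?thesis by simp
  qed
  moreover have "y / m ^ 2 > 0" using y1 m by simp
  ultimately show ?thesis using c by blast
qed

section \<open>Shuffle classes as sets of rearranged combs\<close>

lemma ispos_append: "ispos T (v @ w) \<longleftrightarrow> ispos T v \<and> ispos (subt T v) w"
  by (induction T v rule: ispos.induct) auto

lemma subt_append: "ispos T v \<Longrightarrow> subt T (v @ w) = subt (subt T v) w"
  by (induction T v rule: ispos.induct) auto

lemma repl_append: "ispos T v \<Longrightarrow> repl T (v @ w) S = repl T v (repl (subt T v) w S)"
  by (induction T v rule: ispos.induct) auto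

lemma repl_subt_self: "ispos T v \<Longrightarrow> repl T v (subt T v) = T"
  by (induction T v rule: ispos.induct) auto

lemma subt_repl: "ispos T v \<Longrightarrow> subt (repl T v S) v = S"
  by (induction T v rule: ispos.induct) auto

lemma repl_repl: "ispos T v \<Longrightarrow> repl (repl T v R) v S = repl T v S"
  by (induction T v rule: ispos.induct) auto

lemma ispos_repl: "ispos T v \<Longrightarrow> ispos (repl T v S) v"
  by (induction T v rule: ispos.induct) auto

lemma dcat_subt: "ispos T v \<Longrightarrow> dcat d T \<Longrightarrow> dcat d (subt T v)"
  by (induction T v rule: ispos.induct) (auto simp: list_all_length)

lemma dcat_repl: "ispos T v \<Longrightarrow> dcat d T \<Longrightarrow> dcat d S \<Longrightarrow> dcat d (repl T v S)"
  by (induction T v rule: ispos.induct) (auto simp: list_all_length nth_list_update)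

lemma internal_repl:
  "ispos T v \<Longrightarrow> internal S = internal (subt T v) \<Longrightarrow> internal (repl T v S) = internal T"
proof (induction T v rule: ispos.induct)
  case (2 ts c cs)
  then have "internal (repl (ts ! c) cs S) = internal (ts ! c)" by simp
  then have "map internal (ts[c := repl (ts ! c) cs S]) = map internal ts"
    by (metis list_update_id map_update)
  then show ?case using 2(2) by simp
qed simp

lemma repl_all_Nil [simp]: "repl_all T [] = T"
  and repl_all_Cons [simp]: "repl_all T ((q, S) # rs) = repl_all (repl T q S) rs"
  and repl_all_append: "repl_all T (rs @ rs') = repl_all (repl_all T rs) rs'"
  by (simp_all add: repl_all_def)

lemma repl_all_prefix:
  assumes "ispos T v"
  shows "repl_all T (zip (map ((@) v) P) xs) = repl T v (repl_all (subt T v) (zip P xs))"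
  using assms
proof (induction P arbitrary: T xs)
  case (Cons q P)
  show ?case
  proof (cases xs)
    case xs: (Cons x xs')
    have "repl_all T (zip (map ((@) v) (q # P)) xs)
      = repl (repl T v (repl (subt T v) q x)) v (repl_all (repl (subt T v) q x) (zip P xs'))"
      using Cons by (simp add: xs repl_append ispos_repl subt_repl)
    then show ?thesis using Cons by (simp add: xs repl_repl)
  qed (use Cons in \<open>simp add: repl_subt_self\<close>)
qed (simp add: repl_subt_self)

lemma sibpos_prefix: "sibpos d v cs = map ((@) v) (sibpos d [] cs)"
  by (simp add: sibpos_def map_concat comp_def)

lemma sibpos_Nil [simp]: "sibpos d v [] = []"
  by (simp add: sibpos_def)

lemma sibpos_Cons:
  assumes "c < d"
  shows "sibpos d [] (c # cs) = map (\<lambda>j. [j]) ([0..<c] @ [Suc c..<d]) @ map ((#) c) (sibpos d [] cs)"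
proof -
  have "[0..<d] = [0..<c] @ c # [Suc c..<d]"
    using assms upt_add_eq_append[of 0 c "d - c"] by (simp add: upt_conv_Cons)
  then have "filter (\<lambda>j. j \<noteq> c) [0..<d] = [0..<c] @ [Suc c..<d]"
    by (simp add: filter_id_conv)
  moreover have "[0..<Suc (length cs)] = 0 # map Suc [0..<length cs]"
    by (simp add: upt_conv_Cons map_Suc_upt del: upt_Suc)
  ultimately show ?thesis
    by (simp add: sibpos_def comp_def map_concat del: upt_Suc)
qed

lemma length_sibpos: "\<forall>c\<in>set cs. c < d \<Longrightarrow> length (sibpos d [] cs) = (d - 1) * length cs"
  by (induction cs) (auto simp: sibpos_Cons)

lemma ispos_children_less: "ispos T cs \<Longrightarrow> dcat d T \<Longrightarrow> \<forall>c\<in>set cs. c < d"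
  by (induction T cs rule: ispos.induct) (auto simp: list_all_length)

lemma ispos_sibpos: "ispos S cs \<Longrightarrow> dcat d S \<Longrightarrow> q \<in> set (sibpos d [] cs) \<Longrightarrow> ispos S q"
proof (induction S cs arbitrary: q rule: ispos.induct)
  case (2 ts c cs)
  then have "length ts = d" "c < d" "dcat d (ts ! c)" by (auto simp: list_all_length)
  then show ?case using 2 by (auto simp: sibpos_Cons)
qed simp

text \<open>The tree rebuilt around a path: a spine in the directions \<open>cs\<close> ending in
  \<open>B\<close>, with \<open>d - 1\<close> siblings per level taken from \<open>xs\<close> in the
  order of \<open>sibpos\<close>. A rearrangement of subtrees thereby becomes a rearrangement of the
  list \<open>xs\<close>.\<close>

fun comb :: "nat \<Rightarrow> nat list \<Rightarrow> ptree list \<Rightarrow> ptree \<Rightarrow> ptree" where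
  "comb d [] xs B = B"
| "comb d (c # cs) xs B = Nd (take c xs @ comb d cs (drop (d - 1) xs) B # drop c (take (d - 1) xs))"

lemma repl_all_interval:
  assumes "length ys = b - a" "a \<le> b" "b \<le> length ts"
  shows "repl_all (Nd ts) (zip (map (\<lambda>j. [j]) [a..<b]) ys) = Nd (take a ts @ ys @ drop b ts)"
  using assms
proof (induction ys arbitrary: a ts)
  case (Cons y ys)
  then have "a < b" by auto
  then have "repl_all (Nd ts) (zip (map (\<lambda>j. [j]) [a..<b]) (y # ys))
    = Nd (take (Suc a) (ts[a := y]) @ ys @ drop b (ts[a := y]))"
    using Cons by (simp add: upt_conv_Cons)
  also have "take (Suc a) (ts[a := y]) = take a ts @ [y]"
    using Cons \<open>a < b\<close> by (simp add: take_Suc_conv_app_nth)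
  finally show ?case using \<open>a < b\<close> by simp
qed simp

text \<open>The successive replacements do not disturb one another, since no sibling position of a
  path lies below another one.\<close>

lemma repl_all_sibpos:
  assumes "dcat d S" "ispos S cs" "length xs = (d - 1) * length cs"
  shows "repl_all S (zip (sibpos d [] cs) xs) = comb d cs xs (subt S cs)"
  using assms
proof (induction cs arbitrary: S xs)
  case (Cons c cs)
  obtain ts where S: "S = Nd ts" by (cases S)
  have ts: "length ts = d" "c < d" "dcat d (ts ! c)" "ispos (ts ! c) cs"
    using Cons S by (auto simp: list_all_length)
  define ys where "ys = take (d - 1) xs"
  have ly: "length ys = d - 1" using Cons.prems by (simp add: ys_def)
  \<comment> \<open>The list is consumed in three runs: siblings left of \<open>c\<close>, siblings
    right of \<open>c\<close>, deeper levels. \<open>ts'\<close> is the list of children after the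
    first run.\<close>
  define ts' where "ts' = take c ys @ drop c ts"
  have xs: "xs = take c ys @ drop c ys @ drop (d - 1) xs"
    unfolding ys_def by (metis append_assoc append_take_drop_id)
  have tk: "take c ys = take c xs" using ts by (auto simp: ys_def min_def)
  have cc: "(@) [c] = (#) c" by (rule ext) simp
  have "repl_all S (zip (sibpos d [] (c # cs)) xs)
    = repl_all (repl_all (repl_all (Nd ts) (zip (map (\<lambda>j. [j]) [0..<c]) (take c ys)))
        (zip (map (\<lambda>j. [j]) [Suc c..<d]) (drop c ys)))
        (zip (map ((@) [c]) (sibpos d [] cs)) (drop (d - 1) xs))"
    using ts ly by (subst xs) (simp add: S sibpos_Cons zip_append repl_all_append cc)
  also have "repl_all (Nd ts) (zip (map (\<lambda>j. [j]) [0..<c]) (take c ys)) = Nd ts'"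
    using ts ly by (subst repl_all_interval) (auto simp: ts'_def)
  also have "repl_all (Nd ts') (zip (map (\<lambda>j. [j]) [Suc c..<d]) (drop c ys))
    = Nd (take c ys @ ts ! c # drop c ys)"
    using ts ly by (subst repl_all_interval) (auto simp: ts'_def min_def take_Suc_conv_app_nth take_drop
        drop_Suc Cons_nth_drop_Suc[symmetric])
  also have "repl_all \<dots> (zip (map ((@) [c]) (sibpos d [] cs)) (drop (d - 1) xs))
    = repl (Nd (take c ys @ ts ! c # drop c ys)) [c] (repl_all (ts ! c) (zip (sibpos d [] cs) (drop (d - 1) xs)))"
    using ts ly by (subst repl_all_prefix) (auto simp: nth_append)
  also have "repl_all (ts ! c) (zip (sibpos d [] cs) (drop (d - 1) xs)) = comb d cs (drop (d - 1) xs) (subt (ts ! c) cs)"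
    using Cons ts by (intro Cons.IH) auto
  also have "repl (Nd (take c ys @ ts ! c # drop c ys)) [c] (comb d cs (drop (d - 1) xs) (subt (ts ! c) cs))
    = comb d (c # cs) xs (subt S (c # cs))"
    using ts ly by (simp add: S tk[symmetric] ys_def[symmetric] list_update_append del: One_nat_def)
  finally show ?case .
qed simp

lemma take_drop_take_drop: "c < d \<Longrightarrow> zs = take c zs @ drop c (take (d - 1) zs) @ drop (d - 1) zs"
proof -
  assume "c < d"
  then have "take c zs @ drop c (take (d - 1) zs) = take (d - 1) zs"
    using append_take_drop_id[of c "take (d - 1) zs"] by (auto simp: min_def split: if_splits)
  then show ?thesis by (metis append_assoc append_take_drop_id)
qed

lemma comb_inject:
  assumes "\<forall>c\<in>set cs. c < d" "length xs = (d - 1) * length cs" "length ys = (d - 1) * length cs"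
    and "comb d cs xs B = comb d cs ys B"
  shows "xs = ys"
  using assms
proof (induction cs arbitrary: xs ys)
  case (Cons c cs)
  have *: "c < d" "length (take c xs) = c" "length (take c ys) = c" using Cons.prems by auto
  have "take c xs = take c ys" "comb d cs (drop (d - 1) xs) B = comb d cs (drop (d - 1) ys) B"
    "drop c (take (d - 1) xs) = drop c (take (d - 1) ys)"
    using Cons.prems(4) * by auto
  moreover from this have "drop (d - 1) xs = drop (d - 1) ys"
    using Cons by auto
  moreover have "zs = take c zs @ drop c (take (d - 1) zs) @ drop (d - 1) zs" for zs :: "ptree list"
    using *(1) by (rule take_drop_take_drop)
  ultimately show ?case by metis
qed simp

lemma internal_comb:
  assumes "\<forall>c\<in>set cs. c < d" "length xs = (d - 1) * length cs"
  shows "internal (comb d cs xs B) = length cs + sum_list (map internal xs) + internal B"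
  using assms
proof (induction cs arbitrary: xs)
  case (Cons c cs)
  have "c < d" using Cons by simp
  then have "xs = take c xs @ drop c (take (d - 1) xs) @ drop (d - 1) xs"
    by (rule take_drop_take_drop)
  then have "sum_list (map internal xs) = sum_list (map internal (take c xs))
    + sum_list (map internal (drop c (take (d - 1) xs))) + sum_list (map internal (drop (d - 1) xs))"
    by (metis (no_types) map_append sum_list_append add.assoc)
  then show ?case using Cons by simp
qed simp

lemma dcat_comb:
  assumes "\<forall>c\<in>set cs. c < d" "length xs = (d - 1) * length cs" "\<forall>x\<in>set xs. dcat d x" "dcat d B"
  shows "dcat d (comb d cs xs B)"
  using assms
proof (induction cs arbitrary: xs)
  case (Cons c cs)
  have "dcat d (comb d cs (drop (d - 1) xs) B)"
    using Cons by (intro Cons.IH) (auto dest: in_set_dropD)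
  then show ?case using Cons by (auto simp: list_all_iff dest!: in_set_dropD in_set_takeD)
qed simp

text \<open>An address that can be continued inside the tree ends at an internal vertex, so the
  stepwise conditions amount to validity of the whole address.\<close>

lemma is_path_iff: "is_path T v cs \<longleftrightarrow> ispos T (v @ cs)"
proof -
  have "(\<forall>i<length cs. is_internal S (take i cs) \<and>
      cs ! i < length (case subt S (take i cs) of Nd ts \<Rightarrow> ts)) \<longleftrightarrow> ispos S cs" for S
  proof (induction cs arbitrary: S)
    case (Cons c cs)
    obtain ts where S: "S = Nd ts" by (cases S)
    show ?case
      unfolding length_Cons All_less_Suc2 using Cons[of "ts ! c"]
      by (auto simp: S is_internal_def split: if_splits)
  qed simp
  moreover have "ispos T v \<Longrightarrow> is_internal T (v @ w) \<longleftrightarrow> is_internal (subt T v) w" for w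
    by (auto simp: is_internal_def ispos_append subt_append)
  ultimately show ?thesis
    unfolding is_path_def ispos_append by (metis subt_append)
qed

text \<open>Permutations that only exchange equal entries collapse here, so that each rearranged
  list is counted once.\<close>

lemma permute_list_image:
  "(\<lambda>\<sigma>. permute_list \<sigma> ys) ` {\<sigma>. \<sigma> permutes {..<length ys}} = {xs. mset xs = mset ys}"
proof (intro equalityI subsetI)
  fix xs assume "xs \<in> {xs. mset xs = mset ys}"
  then obtain \<sigma> where "\<sigma> permutes {..<length ys}" "permute_list \<sigma> ys = xs"
    using mset_eq_permutation by blast
  then show "xs \<in> (\<lambda>\<sigma>. permute_list \<sigma> ys) ` {\<sigma>. \<sigma> permutes {..<length ys}}" by blast
qed auto

section \<open>The shuffle class of one tree and one path\<close>

locale comb_path =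
  fixes d k :: nat and T :: ptree and v cs :: "nat list"
  assumes T: "T \<in> catalan d k" and path: "is_path T v cs"
begin

abbreviation "sibs \<equiv> map (subt T) (sibpos d v cs)"
abbreviation "bottom \<equiv> subt T (v @ cs)"

lemma pos: "ispos T v" "ispos (subt T v) cs" and dcat: "dcat d T" "dcat d (subt T v)"
  using T path dcat_subt by (auto simp: is_path_iff ispos_append catalan_def)

lemma cs_less: "\<forall>c\<in>set cs. c < d"
  using ispos_children_less pos dcat by blast

lemma length_sibs: "length sibs = (d - 1) * length cs"
  using length_sibpos cs_less by (subst sibpos_prefix) simp

lemma repl_all_conv_comb:
  "length xs = (d - 1) * length cs \<Longrightarrow> repl_all T (zip (sibpos d v cs) xs) = repl T v (comb d cs xs bottom)"
  using pos dcat by (subst sibpos_prefix) (simp add: repl_all_prefix repl_all_sibpos subt_append)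

lemma repl_comb_sibs: "repl T v (comb d cs sibs bottom) = T"
proof -
  have "\<forall>q\<in>set (sibpos d v cs). ispos T q"
    using pos dcat ispos_sibpos by (subst sibpos_prefix) (auto simp: ispos_append)
  then have "repl_all T (zip P (map (subt T) P)) = T" if "set P \<subseteq> set (sibpos d v cs)" for P
    using that by (induction P) (auto simp: repl_subt_self)
  then show ?thesis using repl_all_conv_comb[OF length_sibs] by auto
qed

lemma shuffle_class_conv:
  "shuffle_class d T v cs = (\<lambda>xs. repl T v (comb d cs xs bottom)) ` {xs. mset xs = mset sibs}"
proof -
  have eq: "map (\<lambda>m. (sibpos d v cs ! m, subt T (sibpos d v cs ! (\<sigma> m)))) [0..<length (sibpos d v cs)]
    = zip (sibpos d v cs) (permute_list \<sigma> sibs)" if "\<sigma> permutes {..<length (sibpos d v cs)}" for \<sigma>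
    using permutes_in_image[OF that] by (intro nth_equalityI) (auto simp: permute_list_def)
  have eq': "repl_all T (map (\<lambda>m. (sibpos d v cs ! m, subt T (sibpos d v cs ! (\<sigma> m)))) [0..<length (sibpos d v cs)])
    = repl T v (comb d cs (permute_list \<sigma> sibs) bottom)" if "\<sigma> permutes {..<length (sibpos d v cs)}" for \<sigma>
    unfolding eq[OF that] using length_sibs by (intro repl_all_conv_comb) simp
  have "shuffle_class d T v cs
    = (\<lambda>\<sigma>. repl T v (comb d cs (permute_list \<sigma> sibs) bottom)) ` {\<sigma>. \<sigma> permutes {..<length sibs}}"
    unfolding shuffle_class_def Let_def setcompr_eq_image
    by (intro image_cong) (auto simp: eq')
  also have "\<dots> = (\<lambda>xs. repl T v (comb d cs xs bottom)) ` ((\<lambda>\<sigma>. permute_list \<sigma> sibs) ` {\<sigma>. \<sigma> permutes {..<length sibs}})"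
    by (simp only: image_image)
  also have "(\<lambda>\<sigma>. permute_list \<sigma> sibs) ` {\<sigma>. \<sigma> permutes {..<length sibs}} = {xs. mset xs = mset sibs}"
    by (rule permute_list_image)
  finally show ?thesis .
qed

text \<open>A shuffle class is a set of trees; injectivity lets a sum over it be taken over the
  distinct rearrangements of the siblings without multiplicities.\<close>

lemma inj_on_comb: "inj_on (\<lambda>xs. repl T v (comb d cs xs bottom)) {xs. mset xs = mset sibs}"
proof (rule inj_onI)
  fix xs ys
  assume *: "xs \<in> {xs. mset xs = mset sibs}" "ys \<in> {xs. mset xs = mset sibs}"
    "repl T v (comb d cs xs bottom) = repl T v (comb d cs ys bottom)"
  then have "comb d cs xs bottom = comb d cs ys bottom" using subt_repl[OF pos(1)] by metis
  moreover have "length xs = (d - 1) * length cs" "length ys = (d - 1) * length cs"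
    using * length_sibs by (metis mem_Collect_eq size_mset)+
  ultimately show "xs = ys" using comb_inject cs_less by blast
qed

lemma shuffle_class_subset: "shuffle_class d T v cs \<subseteq> catalan d k"
proof -
  have "repl T v (comb d cs xs bottom) \<in> catalan d k" if "mset xs = mset sibs" for xs
  proof -
    have len: "length xs = (d - 1) * length cs" using that length_sibs by (metis size_mset)
    have sum: "sum_list (map internal xs) = sum_list (map internal sibs)"
      using that by (metis mset_map sum_mset_sum_list)
    have "\<forall>q\<in>set (sibpos d v cs). ispos T q"
      using pos dcat ispos_sibpos by (subst sibpos_prefix) (auto simp: ispos_append)
    then have "\<forall>x\<in>set xs. dcat d x"
      using dcat_subt dcat(1) mset_eq_setD[OF that] by auto
    moreover have "dcat d bottom" using dcat_subt dcat(1) path by (simp add: is_path_iff)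
    ultimately have "dcat d (comb d cs xs bottom)" using dcat_comb cs_less len by blast
    moreover have "internal (comb d cs xs bottom) = internal (comb d cs sibs bottom)"
      using internal_comb[OF cs_less len] internal_comb[OF cs_less length_sibs] sum by simp
    moreover have "comb d cs sibs bottom = subt T v"
      using repl_comb_sibs subt_repl[OF pos(1)] by metis
    ultimately show ?thesis
      using T pos dcat by (auto simp: catalan_def dcat_repl internal_repl)
  qed
  then show ?thesis unfolding shuffle_class_conv by blast
qed

end

section \<open>Left combs and their trivial shuffle classes\<close>

fun left_comb :: "nat \<Rightarrow> nat \<Rightarrow> ptree" where
  "left_comb d 0 = Nd []"
| "left_comb d (Suc q) = Nd (left_comb d q # replicate (d - 1) (Nd []))"

lemma dcat_left_comb: "d \<ge> 1 \<Longrightarrow> dcat d (left_comb d q)"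
  by (induction q) (auto simp: list_all_iff)

lemma ispos_left_comb: "ispos (left_comb d q) (replicate q 0)"
  by (induction q) auto

lemma subt_sibpos_left_comb:
  "d \<ge> 1 \<Longrightarrow> w \<in> set (sibpos d [] (replicate q 0)) \<Longrightarrow> subt (left_comb d q) w = Nd []"
  by (induction q arbitrary: w) (auto simp: sibpos_Cons nth_Cons')

lemma has_subtree_pos: "has_subtree s T \<Longrightarrow> \<exists>v. ispos T v \<and> subt T v = s"
proof (induction s T rule: has_subtree.induct)
  case (1 s ts)
  show ?case
  proof (cases "Nd ts = s")
    case True
    then show ?thesis by (intro exI[of _ "[]"]) simp
  next
    case False
    then obtain c where c: "c < length ts" "has_subtree s (ts ! c)"
      using 1 by (auto simp: list_ex_iff in_set_conv_nth)
    then obtain v where "ispos (ts ! c) v \<and> subt (ts ! c) v = s" using 1 by force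
    then show ?thesis using c by (intro exI[of _ "c # v"]) simp
  qed
qed

text \<open>All rearranged subtrees below a left comb are leaves, so its shuffle class is trivial.\<close>

lemma singleton_shuffle_class:
  assumes "d \<ge> 1" "T \<in> catalan d k" "has_subtree (left_comb d p) T"
  shows "{T} \<in> shuffle_classes d k p"
proof -
  obtain v where v: "ispos T v" "subt T v = left_comb d p" using has_subtree_pos assms by blast
  let ?cs = "replicate p 0"
  interpret comb_path d k T v ?cs
    using assms v ispos_left_comb by unfold_locales (auto simp: is_path_iff ispos_append)
  have "\<forall>x\<in>set sibs. x = Nd []"
    using v subt_sibpos_left_comb[OF assms(1)] by (subst sibpos_prefix) (auto simp: subt_append)
  then have sibs: "sibs = replicate (length sibs) (Nd [])" by (metis replicate_length_same)
  have "{xs. mset xs = mset sibs} = {sibs}"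
  proof -
    have "xs = sibs" if "mset xs = mset sibs" for xs
    proof -
      have "\<forall>x\<in>set xs. x = Nd []" using \<open>\<forall>x\<in>set sibs. x = Nd []\<close> mset_eq_setD[OF that] by metis
      then have "xs = replicate (length xs) (Nd [])" by (metis replicate_length_same)
      moreover have "length xs = length sibs" using that by (metis size_mset)
      ultimately show ?thesis using sibs by metis
    qed
    then show ?thesis by blast
  qed
  then have eq: "shuffle_class d T v ?cs = {T}"
    unfolding shuffle_class_conv using repl_comb_sibs by simp
  show ?thesis
    unfolding shuffle_classes_def mem_Collect_eq
    by (rule exI[of _ T], rule exI[of _ v], rule exI[of _ ?cs])
      (intro conjI eq[symmetric] assms(2) path length_replicate)
qed

section \<open>Embedding coefficient functions into the ring of power series\<close>

lemma count_mem_mi_iff: "count A \<in> mi n \<longleftrightarrow> set_mset A \<subseteq> {..<n}"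
proof -
  have "(\<forall>j\<ge>n. count A j = 0) \<longleftrightarrow> (\<forall>j. j \<in># A \<longrightarrow> j < n)"
    by (metis count_eq_zero_iff linorder_not_le)
  then show ?thesis by (auto simp: mi_def)
qed

lemma mi_imp_count: "\<alpha> \<in> mi n \<Longrightarrow> \<exists>A. \<alpha> = count A \<and> set_mset A \<subseteq> {..<n}"
proof -
  assume a: "\<alpha> \<in> mi n"
  have "j < n" if "0 < \<alpha> j" for j
    using a that by (cases "j < n") (auto simp: mi_def)
  then have "{j. 0 < \<alpha> j} \<subseteq> {..<n}" by blast
  then have "finite {j. 0 < \<alpha> j}" using finite_subset by blast
  then have "\<alpha> = count (Abs_multiset \<alpha>)" by simp
  then show ?thesis using a count_mem_mi_iff by metis
qed

lemma mdeg_count: "set_mset A \<subseteq> {..<n} \<Longrightarrow> mdeg n (count A) = size A"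
  unfolding mdeg_def size_multiset_overloaded_eq
  by (rule sum.mono_neutral_right) (auto simp: not_in_iff)

definition msets :: "nat \<Rightarrow> nat \<Rightarrow> nat multiset set" where
  "msets n r = {A. size A = r \<and> set_mset A \<subseteq> {..<n}}"

lemma msets_conv_tuples: "msets n r = mset ` tuples {..<n} r"
proof -
  have "A \<in> mset ` tuples {..<n} r" if "A \<in> msets n r" for A
    using that ex_mset[of A] by (auto simp: msets_def tuples_def image_iff)
  then show ?thesis by (auto simp: msets_def tuples_def)
qed

lemma finite_msets [simp]: "finite (msets n r)"
  by (simp add: msets_conv_tuples)

lemma mi_conv_msets: "{\<beta> \<in> mi n. mdeg n \<beta> = r} = count ` msets n r"
proof (intro equalityI subsetI)
  fix \<beta> assume *: "\<beta> \<in> {\<beta> \<in> mi n. mdeg n \<beta> = r}"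
  then obtain A where "\<beta> = count A" "set_mset A \<subseteq> {..<n}" using mi_imp_count by blast
  then show "\<beta> \<in> count ` msets n r" using * mdeg_count by (auto simp: msets_def)
qed (auto simp: msets_def count_mem_mi_iff mdeg_count)

lemma inj_count: "inj_on count S"
  by (simp add: inj_on_def count_inject)

text \<open>The multinomial coefficient as a number of words with given content: the bridge between
  the factors \<open>1/\<alpha>!\<close> and sums over ordered words with the single factor
  \<open>1/d!\<close>.\<close>

lemma card_permutations_mfact:
  assumes "set_mset A \<subseteq> {..<n}"
  shows "card (permutations_of_multiset A) * mfact n (count A) = fact (size A)"
proof -
  have "mfact n (count A) = (\<Prod>x\<in>set_mset A. fact (count A x))"
    unfolding mfact_def by (rule prod.mono_neutral_right) (use assms in \<open>auto simp: not_in_iff\<close>)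
  then show ?thesis using card_permutations_of_multiset_aux[of A] by simp
qed

lemma mfact_pos [simp]: "mfact n \<alpha> > 0"
  by (auto simp: mfact_def)

lemma permutations_conv_tuples:
  "A \<in> msets n r \<Longrightarrow> {js \<in> tuples {..<n} r. mset js = A} = permutations_of_multiset A"
  by (auto simp: msets_def tuples_def permutations_of_multiset_def)

lemma sum_tuples_by_mset:
  fixes F :: "nat list \<Rightarrow> 'a :: comm_monoid_add"
  shows "(\<Sum>js\<in>tuples {..<n} r. F js) = (\<Sum>A\<in>msets n r. \<Sum>js\<in>permutations_of_multiset A. F js)"
proof -
  have "(\<Sum>js\<in>tuples {..<n} r. F js) = (\<Sum>A\<in>msets n r. sum F {js \<in> tuples {..<n} r. mset js = A})"
    unfolding msets_conv_tuples by (rule sum.image_gen) simp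
  then show ?thesis by (simp add: permutations_conv_tuples)
qed

text \<open>Monomials with a variable outside the first \<open>n\<close> get coefficient 0. Thus
  functions agreeing on \<open>mi n\<close> have equal images, and \<open>smul n\<close> becomes the
  ring product.\<close>

definition mps_of :: "nat \<Rightarrow> fps_n \<Rightarrow> mps" where
  "mps_of n f = Mps (\<lambda>A. if set_mset A \<subseteq> {..<n} then f (count A) else 0)"

lemma mcoeff_mps_of: "mcoeff (mps_of n f) A = (if set_mset A \<subseteq> {..<n} then f (count A) else 0)"
  by (simp add: mps_of_def)

lemma mps_of_eqI: "(\<And>\<alpha>. \<alpha> \<in> mi n \<Longrightarrow> f \<alpha> = g \<alpha>) \<Longrightarrow> mps_of n f = mps_of n g"
  by (rule mps_eqI) (auto simp: mcoeff_mps_of count_mem_mi_iff)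

lemma mps_of_eqD:
  assumes "mps_of n f = mps_of n g" "\<alpha> \<in> mi n"
  shows "f \<alpha> = g \<alpha>"
proof -
  obtain A where "\<alpha> = count A" "set_mset A \<subseteq> {..<n}" using mi_imp_count[OF assms(2)] by blast
  then show ?thesis using arg_cong[OF assms(1), of "\<lambda>f. mcoeff f A"] by (simp add: mcoeff_mps_of)
qed

lemma below_count:
  assumes "set_mset A \<subseteq> {..<n}"
  shows "below n (count A) = count ` {B. B \<subseteq># A}"
proof (intro equalityI subsetI)
  fix \<beta> assume b: "\<beta> \<in> below n (count A)"
  then have "\<beta> \<in> mi n" by (simp add: below_def mi_def)
  then obtain B where "\<beta> = count B" using mi_imp_count by blast
  then show "\<beta> \<in> count ` {B. B \<subseteq># A}" using b by (auto simp: below_def subseteq_mset_def)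
next
  fix \<beta> assume "\<beta> \<in> count ` {B. B \<subseteq># A}"
  then obtain B where B: "\<beta> = count B" "B \<subseteq># A" by blast
  then have "set_mset B \<subseteq> {..<n}" using assms set_mset_mono by blast
  then have "\<beta> \<in> mi n" using B count_mem_mi_iff by simp
  then show "\<beta> \<in> below n (count A)" using B by (simp add: below_def mi_def subseteq_mset_def)
qed

lemma mps_of_smul: "mps_of n (smul n f g) = mps_of n f * mps_of n g"
proof (rule mps_eqI)
  fix A
  show "mcoeff (mps_of n (smul n f g)) A = mcoeff (mps_of n f * mps_of n g) A"
  proof (cases "set_mset A \<subseteq> {..<n}")
    case True
    have "mcoeff (mps_of n (smul n f g)) A = (\<Sum>B\<in>{B. B \<subseteq># A}. f (count B) * g (\<lambda>j. count A j - count B j))"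
      using True by (simp add: mcoeff_mps_of smul_def below_count sum.reindex[OF inj_count])
    also have "\<dots> = (\<Sum>B\<in>{B. B \<subseteq># A}. mcoeff (mps_of n f) B * mcoeff (mps_of n g) (A - B))"
    proof (rule sum.cong)
      fix B assume "B \<in> {B. B \<subseteq># A}"
      then have "set_mset B \<subseteq> {..<n}" "set_mset (A - B) \<subseteq> {..<n}"
        using True set_mset_mono[of B A] set_mset_mono[of "A - B" A] by auto
      moreover have "count (A - B) = (\<lambda>j. count A j - count B j)" by (rule ext) simp
      ultimately show "f (count B) * g (\<lambda>j. count A j - count B j) = mcoeff (mps_of n f) B * mcoeff (mps_of n g) (A - B)"
        by (simp add: mcoeff_mps_of)
    qed simp
    finally show ?thesis by (simp add: mcoeff_mult)
  next
    case False
    have "mcoeff (mps_of n f) B * mcoeff (mps_of n g) (A - B) = 0" if "B \<subseteq># A" for B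
    proof -
      have "set_mset A = set_mset B \<union> set_mset (A - B)"
        using that by (metis set_mset_union subset_mset.add_diff_inverse)
      then show ?thesis using False by (auto simp: mcoeff_mps_of)
    qed
    then have "(\<Sum>B\<in>{B. B \<subseteq># A}. mcoeff (mps_of n f) B * mcoeff (mps_of n g) (A - B)) = 0"
      by (intro sum.neutral) blast
    then show ?thesis using False by (simp add: mcoeff_mps_of[of n "smul n f g"] mcoeff_mult)
  qed
qed

lemma mps_of_sone: "mps_of n sone = 1"
proof (rule mps_eqI)
  fix A :: "nat multiset"
  have "count A = (\<lambda>_. 0) \<longleftrightarrow> A = {#}" by (auto simp: multiset_eq_iff)
  then show "mcoeff (mps_of n sone) A = mcoeff 1 A" by (auto simp: mcoeff_mps_of sone_def mcoeff_1)
qed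

lemma mps_of_add: "mps_of n (\<lambda>\<alpha>. f \<alpha> + g \<alpha>) = mps_of n f + mps_of n g"
  and mps_of_scale: "mps_of n (\<lambda>\<alpha>. c * f \<alpha>) = cst c * mps_of n f"
  and mps_of_zero: "mps_of n (\<lambda>\<alpha>. 0) = 0"
  and mps_of_sum: "mps_of n (\<lambda>\<alpha>. \<Sum>i\<in>I. h i \<alpha>) = (\<Sum>i\<in>I. mps_of n (h i))"
  by (rule mps_eqI; simp add: mcoeff_mps_of)+

lemma mps_of_unitv:
  assumes "i < n"
  shows "mps_of n (\<lambda>\<alpha>. if \<alpha> = unitv i then 1 else 0) = Var i"
proof (rule mps_eqI)
  fix A
  have "count A = unitv i \<longleftrightarrow> A = {#i#}" by (auto simp: multiset_eq_iff unitv_def fun_eq_iff)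
  then show "mcoeff (mps_of n (\<lambda>\<alpha>. if \<alpha> = unitv i then 1 else 0)) A = mcoeff (Var i) A"
    using assms by (auto simp: mcoeff_mps_of mcoeff_Var)
qed

lemma mps_of_spow: "mps_of n (spow n f m) = mps_of n f ^ m"
  by (induction m) (simp_all add: spow_def mps_of_sone mps_of_smul)

lemma mps_of_smono: "mps_of n (smono n G \<beta>) = (\<Prod>j<n. mps_of n (G j) ^ \<beta> j)"
proof -
  have "mps_of n (foldr (\<lambda>j acc. smul n (spow n (G j) (\<beta> j)) acc) xs sone) = (\<Prod>j\<leftarrow>xs. mps_of n (G j) ^ \<beta> j)" for xs
    by (induction xs) (simp_all add: mps_of_sone mps_of_smul mps_of_spow)
  then show ?thesis
    by (simp add: smono_def prod.distinct_set_conv_list[symmetric] atLeast0LessThan)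
qed

section \<open>The polynomial map as a symmetric multilinear form\<close>

lemma prod_list_map_conv_count:
  fixes E :: "nat \<Rightarrow> 'a :: comm_monoid_mult"
  assumes "set js \<subseteq> {..<n}"
  shows "prod_list (map E js) = (\<Prod>j<n. E j ^ count (mset js) j)"
proof -
  have "prod_list (map E js) = prod_mset (image_mset E (mset js))"
    by (metis mset_map prod_mset_prod_list)
  also have "\<dots> = (\<Prod>j\<in>set_mset (mset js). E j ^ count (mset js) j)"
    by (rule image_prod_mset_multiplicity)
  finally have 1: "prod_list (map E js) = (\<Prod>j\<in>set_mset (mset js). E j ^ count (mset js) j)" .
  have cz: "count (mset js) j = 0" if "j \<notin> set js" for j
    using that by (simp add: count_eq_zero_iff)
  then have "(\<Prod>j\<in>set_mset (mset js). E j ^ count (mset js) j) = (\<Prod>j<n. E j ^ count (mset js) j)"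
    using assms by (intro prod.mono_neutral_left) (auto simp: cz)
  then show ?thesis using 1 by simp
qed

text \<open>A monomial with exponent \<beta> arises from \<open>d!/\<beta>!\<close> words, so the
  uniform factor \<open>1/d!\<close> replaces all the factors \<open>1/\<beta>!\<close>. The ordered
  factors later become the ordered children of a vertex.\<close>

definition Hlist :: "nat \<Rightarrow> nat \<Rightarrow> (nat \<Rightarrow> (nat \<Rightarrow> nat) \<Rightarrow> complex) \<Rightarrow> (nat \<Rightarrow> mps) \<Rightarrow> nat \<Rightarrow> mps" where
  "Hlist n d Hc G i = cst (1 / fact d) *
     (\<Sum>js\<in>tuples {..<n} d. cst (Hc i (count (mset js))) * prod_list (map G js))"

lemma mps_of_Hcomp: "mps_of n (Hcomp n d Hc g i) = Hlist n d Hc (\<lambda>j. mps_of n (g j)) i"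
proof -
  let ?P = "\<lambda>A. \<Prod>j<n. mps_of n (g j) ^ count A j"
  have "Hlist n d Hc (\<lambda>j. mps_of n (g j)) i
    = cst (1 / fact d) * (\<Sum>js\<in>tuples {..<n} d. cst (Hc i (count (mset js))) * ?P (mset js))"
    unfolding Hlist_def
    by (intro arg_cong[of _ _ "(*) _"] sum.cong) (auto simp: tuples_def prod_list_map_conv_count[of _ n])
  also have "\<dots> = cst (1 / fact d) * (\<Sum>A\<in>msets n d. \<Sum>js\<in>permutations_of_multiset A. cst (Hc i (count A)) * ?P A)"
    unfolding sum_tuples_by_mset
    by (intro arg_cong[of _ _ "(*) _"] sum.cong) (auto simp: permutations_of_multiset_def)
  also have "\<dots> = (\<Sum>A\<in>msets n d. cst (1 / fact d * (of_nat (card (permutations_of_multiset A)) * Hc i (count A))) * ?P A)"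
    by (simp only: sum_constant sum_distrib_left cst_mult cst_of_nat mult.assoc)
  also have "\<dots> = (\<Sum>A\<in>msets n d. cst (Hc i (count A) / of_nat (mfact n (count A))) * ?P A)"
  proof (rule sum.cong)
    fix A assume "A \<in> msets n d"
    then have "card (permutations_of_multiset A) * mfact n (count A) = fact d"
      using card_permutations_mfact[of A n] by (auto simp: msets_def)
    then have "of_nat (card (permutations_of_multiset A)) * of_nat (mfact n (count A)) = (fact d :: complex)"
      by (metis of_nat_fact of_nat_mult)
    moreover have "(of_nat (mfact n (count A)) :: complex) \<noteq> 0"
      by (metis mfact_pos of_nat_eq_0_iff less_numeral_extra(3))
    ultimately have "1 / fact d * (of_nat (card (permutations_of_multiset A)) * Hc i (count A))
      = Hc i (count A) / of_nat (mfact n (count A))"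
      by (simp add: field_simps)
    then show "cst (1 / fact d * (of_nat (card (permutations_of_multiset A)) * Hc i (count A))) * ?P A
      = cst (Hc i (count A) / of_nat (mfact n (count A))) * ?P A" by simp
  qed simp
  also have "\<dots> = mps_of n (Hcomp n d Hc g i)"
    unfolding Hcomp_def mi_conv_msets
    by (simp only: mps_of_sum mps_of_scale mps_of_smono sum.reindex[OF inj_count] comp_def)
  finally show ?thesis by simp
qed

lemma is_inverse_iff:
  "is_inverse n d Hc g \<longleftrightarrow> (\<forall>i<n. mord 1 (mps_of n (g i)) \<and>
     mps_of n (g i) = Var i + Hlist n d Hc (\<lambda>j. mps_of n (g j)) i)"
proof -
  have m: "mord 1 (mps_of n f) \<longleftrightarrow> f (\<lambda>_. 0) = 0" for f
  proof -
    have c: "count {#} = (\<lambda>_. 0::nat)" by (rule ext) simp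
    show ?thesis by (auto simp: mord_def mcoeff_mps_of c)
  qed
  have "(\<forall>\<alpha>\<in>mi n. g i \<alpha> - Hcomp n d Hc g i \<alpha> = (if \<alpha> = unitv i then 1 else 0))
    \<longleftrightarrow> mps_of n (g i) = Var i + Hlist n d Hc (\<lambda>j. mps_of n (g j)) i" if "i < n" for i
  proof -
    have "Var i + Hlist n d Hc (\<lambda>j. mps_of n (g j)) i
      = mps_of n (\<lambda>\<alpha>. (if \<alpha> = unitv i then 1 else 0) + Hcomp n d Hc g i \<alpha>)"
      unfolding mps_of_add mps_of_Hcomp using mps_of_unitv[OF that] by simp
    then show ?thesis
      by (auto simp: algebra_simps intro!: mps_of_eqI dest: mps_of_eqD)
  qed
  then show ?thesis using m by (auto simp: is_inverse_def)
qed

section \<open>The tree expansion of the inverse\<close>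

text \<open>Sum over all labellings of the vertices by \<open>{..<n}\<close> with root label
  \<open>i\<close>: a leaf contributes the variable of its label, an internal vertex the coefficient
  given by its own label and the content of its children's labels. The factors \<open>1/d!\<close>
  are kept outside.\<close>

fun weight :: "nat \<Rightarrow> (nat \<Rightarrow> (nat \<Rightarrow> nat) \<Rightarrow> complex) \<Rightarrow> ptree \<Rightarrow> nat \<Rightarrow> mps" where
  "weight n Hc (Nd us) = (\<lambda>i. if us = [] then Var i
     else \<Sum>js\<in>tuples {..<n} (length us). cst (Hc i (count (mset js))) *
       (\<Prod>(j, w)\<leftarrow>zip js (map (weight n Hc) us). w j))"

declare weight.simps [simp del]

definition fweight :: "nat \<Rightarrow> (nat \<Rightarrow> (nat \<Rightarrow> nat) \<Rightarrow> complex) \<Rightarrow> nat list \<Rightarrow> ptree list \<Rightarrow> mps" where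
  "fweight n Hc js ts = (\<Prod>(j, t)\<leftarrow>zip js ts. weight n Hc t j)"

lemma weight_leaf [simp]: "weight n Hc (Nd []) i = Var i"
  by (simp add: weight.simps)

lemma weight_node:
  "us \<noteq> [] \<Longrightarrow> weight n Hc (Nd us) i
     = (\<Sum>js\<in>tuples {..<n} (length us). cst (Hc i (count (mset js))) * fweight n Hc js us)"
  by (simp add: weight.simps fweight_def zip_map2 comp_def case_prod_beta')

lemma fweight_Nil [simp]: "fweight n Hc [] [] = 1"
  and fweight_Cons [simp]: "fweight n Hc (j # js) (t # ts) = weight n Hc t j * fweight n Hc js ts"
  by (simp_all add: fweight_def)

lemma fweight_append:
  "length js = length ts \<Longrightarrow> fweight n Hc (js @ js') (ts @ ts') = fweight n Hc js ts * fweight n Hc js' ts'"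
  by (simp add: fweight_def)

text \<open>Substituting the equation for the first factor of a product of components of the inverse
  corresponds to removing the root of the first tree of a forest.\<close>

lemma prod_inverse_conv_forests:
  fixes G :: "nat \<Rightarrow> mps"
  assumes d: "d \<ge> 2"
    and G: "\<And>i. i < n \<Longrightarrow> G i = Var i + Hlist n d Hc G i" and G1: "\<And>i. i < n \<Longrightarrow> mord 1 (G i)"
    and "set js \<subseteq> {..<n}" "size A = (d - 1) * k + length js"
  shows "mcoeff (prod_list (map G js)) A
    = (\<Sum>ts\<in>forests d (length js) k. (1 / fact d) ^ k * mcoeff (fweight n Hc js ts) A)"
proof -
  have d1: "d \<ge> 1" using d by simp
  have split: "mcoeff (prod_list (map G (j # js))) A
    = mcoeff (Var j * prod_list (map G js)) A + 1 / fact d *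
      (\<Sum>js'\<in>tuples {..<n} d. Hc j (count (mset js')) * mcoeff (prod_list (map G (js' @ js))) A)"
    if "j < n" for j js A
  proof -
    have "prod_list (map G (j # js)) = (Var j + Hlist n d Hc G j) * prod_list (map G js)"
      using G[OF that] by simp
    also have "\<dots> = Var j * prod_list (map G js) + cst (1 / fact d) *
      (\<Sum>js'\<in>tuples {..<n} d. cst (Hc j (count (mset js'))) * prod_list (map G (js' @ js)))"
      by (simp add: Hlist_def distrib_right sum_distrib_right mult.assoc)
    finally show ?thesis by simp
  qed
  have small: "mcoeff (prod_list (map G js)) A = 0" if "set js \<subseteq> {..<n}" "size A < length js" for js A
  proof -
    have "mord (length (map G js)) (prod_list (map G js))"
      using that G1 by (intro mord_prod_list) auto
    then show ?thesis using that by (simp add: mord_def)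
  qed
  show ?thesis using assms(4,5)
  proof (induction k arbitrary: js A)
    case 0
    then show ?case
    proof (induction js arbitrary: A)
      case Nil
      then show ?case by (simp add: forests_0)
    next
      case (Cons j js)
      \<comment> \<open>Here \<open>A\<close> has degree \<open>1 + length js\<close>, less than the
        number \<open>d + length js\<close> of factors, each of which has order at least 1. So the
        nonlinear part is invisible and the first tree must be a leaf.\<close>
      have "mcoeff (prod_list (map G (js' @ js))) A = 0" if "js' \<in> tuples {..<n} d" for js'
        using that Cons.prems d by (intro small) (auto simp: tuples_def)
      then have "mcoeff (prod_list (map G (j # js))) A = mcoeff (Var j * prod_list (map G js)) A"
        using Cons.prems by (subst split) auto
      also have "\<dots> = (\<Sum>ts\<in>forests d (length js) 0. mcoeff (Var j * fweight n Hc js ts) A)"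
        using Cons by (auto simp: mcoeff_Var_mult size_Diff_singleton)
      finally show ?case by (simp add: sum_forests_Suc_0)
    qed
  next
    case (Suc k)
    note outer = Suc.IH
    from Suc.prems show ?case
    proof (induction js arbitrary: A)
      case Nil
      then have "size A > 0" using d by simp
      then show ?case by (auto simp: forests_0 mcoeff_1)
    next
      case (Cons j js)
      have j: "j < n" using Cons.prems by simp
      let ?F = "forests d (d + length js) k"
      have 1: "mcoeff (Var j * prod_list (map G js)) A
        = (\<Sum>ts\<in>forests d (length js) (Suc k). (1 / fact d) ^ Suc k * mcoeff (fweight n Hc (j # js) (Nd [] # ts)) A)"
        using Cons by (auto simp: mcoeff_Var_mult size_Diff_singleton)
      have "mcoeff (prod_list (map G (js' @ js))) A
        = (\<Sum>ws\<in>?F. (1 / fact d) ^ k * mcoeff (fweight n Hc (js' @ js) ws) A)"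
        if "js' \<in> tuples {..<n} d" for js'
      proof -
        \<comment> \<open>Opening a root adds \<open>d - 1\<close> factors and uses up one internal
          vertex, so the degree \<open>(d - 1) k + length js\<close> is preserved.\<close>
        have "size A = (d - 1) * k + length (js' @ js)"
          using Cons.prems that d by (cases d) (auto simp: tuples_def algebra_simps)
        then show ?thesis
          using outer[of "js' @ js" A] Cons.prems that by (auto simp: tuples_def)
      qed
      then have "1 / fact d * (\<Sum>js'\<in>tuples {..<n} d. Hc j (count (mset js')) * mcoeff (prod_list (map G (js' @ js))) A)
        = 1 / fact d * (\<Sum>js'\<in>tuples {..<n} d. Hc j (count (mset js')) *
            (\<Sum>ws\<in>?F. (1 / fact d) ^ k * mcoeff (fweight n Hc (js' @ js) ws) A))"
        by simp
      also have "\<dots> = (\<Sum>js'\<in>tuples {..<n} d. \<Sum>ws\<in>?F.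
          (1 / fact d) ^ Suc k * (Hc j (count (mset js')) * mcoeff (fweight n Hc (js' @ js) ws) A))"
        by (simp add: sum_distrib_left mult_ac)
      also have "\<dots> = (\<Sum>ws\<in>?F. \<Sum>js'\<in>tuples {..<n} d.
          (1 / fact d) ^ Suc k * (Hc j (count (mset js')) * mcoeff (fweight n Hc (js' @ js) ws) A))"
        by (rule sum.swap)
      also have "\<dots> = (\<Sum>ws\<in>?F. (1 / fact d) ^ Suc k *
          mcoeff (fweight n Hc (j # js) (Nd (take d ws) # drop d ws)) A)"
      proof (rule sum.cong)
        fix ws assume ws: "ws \<in> ?F"
        then have len: "length (take d ws) = d" by (simp add: forests_def)
        then have ne: "take d ws \<noteq> []" using d by (metis list.size(3) not_numeral_le_zero)
        have "fweight n Hc (j # js) (Nd (take d ws) # drop d ws)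
          = (\<Sum>js'\<in>tuples {..<n} d. cst (Hc j (count (mset js'))) * (fweight n Hc js' (take d ws) * fweight n Hc js (drop d ws)))"
          by (simp only: fweight_Cons weight_node[OF ne] len sum_distrib_right mult.assoc)
        also have "\<dots> = (\<Sum>js'\<in>tuples {..<n} d. cst (Hc j (count (mset js'))) * fweight n Hc (js' @ js) ws)"
        proof (rule sum.cong)
          fix js' assume "js' \<in> tuples {..<n} d"
          then have "fweight n Hc (js' @ js) (take d ws @ drop d ws) = fweight n Hc js' (take d ws) * fweight n Hc js (drop d ws)"
            using len by (intro fweight_append) (simp add: tuples_def)
          then show "cst (Hc j (count (mset js'))) * (fweight n Hc js' (take d ws) * fweight n Hc js (drop d ws))
            = cst (Hc j (count (mset js'))) * fweight n Hc (js' @ js) ws" by simp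
        qed simp
        finally show "(\<Sum>js'\<in>tuples {..<n} d. (1 / fact d) ^ Suc k * (Hc j (count (mset js')) * mcoeff (fweight n Hc (js' @ js) ws) A))
          = (1 / fact d) ^ Suc k * mcoeff (fweight n Hc (j # js) (Nd (take d ws) # drop d ws)) A"
          by (simp add: sum_distrib_left)
      qed simp
      finally have 2: "1 / fact d * (\<Sum>js'\<in>tuples {..<n} d. Hc j (count (mset js')) * mcoeff (prod_list (map G (js' @ js))) A)
        = (\<Sum>ws\<in>?F. (1 / fact d) ^ Suc k * mcoeff (fweight n Hc (j # js) (Nd (take d ws) # drop d ws)) A)" .
      show ?case
        unfolding split[OF j] 1 2 using sum_forests_Suc_Suc[OF d1, where r = "length js" and k = k
            and f = "\<lambda>ts. (1 / fact d) ^ Suc k * mcoeff (fweight n Hc (j # js) ts) A"]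
        by (simp only: length_Cons)
    qed
  qed
qed

lemma inverse_conv_catalan:
  assumes d: "d \<ge> 2" and "is_inverse n d Hc g" "i < n" and A: "set_mset A \<subseteq> {..<n}" "size A = (d - 1) * k + 1"
  shows "g i (count A) = (\<Sum>T\<in>catalan d k. (1 / fact d) ^ k * mcoeff (weight n Hc T i) A)"
proof -
  have "mcoeff (prod_list (map (\<lambda>j. mps_of n (g j)) [i])) A
    = (\<Sum>ts\<in>forests d (length [i]) k. (1 / fact d) ^ k * mcoeff (fweight n Hc [i] ts) A)"
    using assms(2-) by (intro prod_inverse_conv_forests[OF d]) (auto simp: is_inverse_iff)
  also have "\<dots> = (\<Sum>ts\<in>forests d 1 k. (1 / fact d) ^ k * mcoeff (weight n Hc (hd ts) i) A)"
    by (auto simp: forests_def length_Suc_conv intro!: sum.cong)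
  finally show ?thesis using A by (simp add: sum_catalan_conv_forests mcoeff_mps_of)
qed

section \<open>Majorants\<close>

text \<open>Majorant series with nonnegative real coefficients; tree weights are built by sums and
  products, both of which respect majorants.\<close>

definition dominated :: "mps \<Rightarrow> mps \<Rightarrow> bool" where
  "dominated f g \<longleftrightarrow> (\<forall>A. mcoeff g A \<in> \<real> \<and> norm (mcoeff f A) \<le> Re (mcoeff g A))"

lemma dominated_sum: "(\<And>i. i \<in> I \<Longrightarrow> dominated (f i) (g i)) \<Longrightarrow> dominated (sum f I) (sum g I)"
  by (auto simp: dominated_def intro!: order_trans[OF norm_sum] sum_mono)

lemma dominated_mult: 
  assumes "dominated f g" "dominated f' g'"
  shows "dominated (f * f') (g * g')"
  unfolding dominated_def
proof (intro allI conjI)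
  fix A
  have re: "Re (x * y) = Re x * Re y" if "x \<in> \<real>" for x y :: complex
    using that by (auto simp: Reals_def)
  show "mcoeff (g * g') A \<in> \<real>" using assms by (auto simp: mcoeff_mult dominated_def)
  have "norm (mcoeff (f * f') A) \<le> (\<Sum>B\<in>{B. B \<subseteq># A}. norm (mcoeff f B) * norm (mcoeff f' (A - B)))"
    unfolding mcoeff_mult by (rule order_trans[OF norm_sum]) (simp add: norm_mult)
  also have "\<dots> \<le> (\<Sum>B\<in>{B. B \<subseteq># A}. Re (mcoeff g B) * Re (mcoeff g' (A - B)))"
    using assms by (intro sum_mono mult_mono) (auto simp: dominated_def intro: order_trans[OF norm_ge_zero])
  also have "\<dots> = Re (mcoeff (g * g') A)"
    using assms by (simp add: mcoeff_mult re dominated_def del: times_complex.sel)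
  finally show "norm (mcoeff (f * f') A) \<le> Re (mcoeff (g * g') A)" .
qed

lemma dominated_cst: "norm c \<le> r \<Longrightarrow> dominated (cst c) (cst (of_real r))"
  by (auto simp: dominated_def cst.rep_eq)

lemma dominated_weight:
  assumes "\<And>i \<beta>. i < n \<Longrightarrow> \<beta> \<in> mi n \<Longrightarrow> mdeg n \<beta> = d \<Longrightarrow> norm (Hc i \<beta>) \<le> L" "dcat d T" "i < n"
  shows "dominated (weight n Hc T i) (weight n (\<lambda>_ _. of_real L) T i)"
  using assms(2,3)
proof (induction T arbitrary: i)
  case (Nd us)
  show ?case
  proof (cases "us = []")
    case True
    then show ?thesis by (auto simp: dominated_def mcoeff_Var)
  next
    case False
    then have us: "length us = d" "\<forall>u\<in>set us. dcat d u" using dcat_NdD Nd.prems by blast+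
    have fw: "dominated (fweight n Hc js ts) (fweight n (\<lambda>_ _. of_real L) js ts)"
      if "set js \<subseteq> {..<n}" "length js = length ts" "set ts \<subseteq> set us" for js ts
      using that(2,1,3)
    proof (induction js ts rule: list_induct2)
      case Nil
      then show ?case by (simp add: dominated_def mcoeff_1)
    next
      case (Cons j js t ts)
      then show ?case using Nd.IH us by (auto intro!: dominated_mult)
    qed
    have "dominated (cst (Hc i (count (mset js)))) (cst (of_real L))" if "js \<in> tuples {..<n} d" for js
    proof -
      have "mset js \<in> msets n d" using that by (auto simp: msets_conv_tuples)
      then have "norm (Hc i (count (mset js))) \<le> L"
        using assms(1)[OF Nd.prems(2)] mdeg_count count_mem_mi_iff by (auto simp: msets_def)
      then show ?thesis by (rule dominated_cst)
    qed
    then show ?thesis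
      unfolding weight_node[OF False] using fw us
      by (intro dominated_sum dominated_mult) (auto simp: tuples_def)
  qed
qed

text \<open>With constant coefficients the sum over child labels factors into independent sums, and
  an internal root no longer depends on its label. Fixing \<open>i\<close> therefore saves one
  factor \<open>n\<close>, the origin of the exponent \<open>k - 1\<close>. The induction needs the
  summed form for the children, which, unlike the form with fixed \<open>i\<close>, also covers
  leaves.\<close>

lemma weight_const_aux:
  assumes "dcat d T" "d \<ge> 1"
  shows "(\<Sum>i<n. weight n (\<lambda>_ _. c) T i)
      = cst ((of_nat n * c) ^ internal T) * (\<Sum>j<n. Var j) ^ ((d - 1) * internal T + 1)
    \<and> (T \<noteq> Nd [] \<longrightarrow> (\<forall>i. weight n (\<lambda>_ _. c) T i
      = cst (c * (of_nat n * c) ^ (internal T - 1)) * (\<Sum>j<n. Var j) ^ ((d - 1) * internal T + 1)))"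
  using assms(1)
proof (induction T)
  case (Nd us)
  let ?S = "\<Sum>j<n. Var j"
  have node: "weight n (\<lambda>_ _. c) (Nd us) i
      = cst (c * (of_nat n * c) ^ (internal (Nd us) - 1)) * ?S ^ ((d - 1) * internal (Nd us) + 1)"
    if ne: "us \<noteq> []" for i
  proof -
    have us: "length us = d" "\<forall>u\<in>set us. dcat d u" using dcat_NdD Nd.prems ne by blast+
    have P: "(\<Prod>u\<leftarrow>ts. cst ((of_nat n * c) ^ internal u) * ?S ^ ((d - 1) * internal u + 1))
      = cst ((of_nat n * c) ^ sum_list (map internal ts)) * ?S ^ ((d - 1) * sum_list (map internal ts) + length ts)" for ts
      by (induction ts) (simp_all add: power_add cst_mult mult_ac distrib_left)
    have "weight n (\<lambda>_ _. c) (Nd us) i = cst c * (\<Sum>js\<in>tuples {..<n} (length us). fweight n (\<lambda>_ _. c) js us)"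
      by (simp add: weight_node[OF ne] sum_distrib_left)
    also have "(\<Sum>js\<in>tuples {..<n} (length us). fweight n (\<lambda>_ _. c) js us) = (\<Prod>u\<leftarrow>us. \<Sum>j<n. weight n (\<lambda>_ _. c) u j)"
      unfolding fweight_def by (rule sum_tuples_prod_list)
    also have "\<dots> = (\<Prod>u\<leftarrow>us. cst ((of_nat n * c) ^ internal u) * ?S ^ ((d - 1) * internal u + 1))"
      using Nd.IH us by (intro arg_cong[of _ _ prod_list] map_cong) auto
    also note P
    also have "(d - 1) * sum_list (map internal us) + length us = (d - 1) * internal (Nd us) + 1"
      using us ne assms(2) by (simp add: distrib_left)
    finally show ?thesis using ne by (simp add: cst_mult mult.assoc)
  qed
  have "(\<Sum>i<n. weight n (\<lambda>_ _. c) (Nd us) i)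
    = cst ((of_nat n * c) ^ internal (Nd us)) * ?S ^ ((d - 1) * internal (Nd us) + 1)"
  proof (cases "us = []")
    case False
    then have "(of_nat n * c) ^ internal (Nd us) = of_nat n * (c * (of_nat n * c) ^ (internal (Nd us) - 1))"
      by simp
    then have "cst ((of_nat n * c) ^ internal (Nd us)) = of_nat n * cst (c * (of_nat n * c) ^ (internal (Nd us) - 1))"
      by (simp only: cst_mult cst_of_nat)
    then show ?thesis unfolding node[OF False] by (simp add: mult.assoc)
  qed simp
  then show ?case using node by blast
qed

lemmas weight_const = weight_const_aux[THEN conjunct2, rule_format]

lemma mcoeff_sum_Var_power:
  assumes "A \<in> msets n m"
  shows "mcoeff ((\<Sum>j<n. Var j) ^ m) A = fact m / of_nat (mfact n (count A))"
proof -
  have "(\<Sum>j<n. Var j) ^ m = (\<Sum>js\<in>tuples {..<n} m. \<Prod>(j, u)\<leftarrow>zip js (replicate m ()). Var j)"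
    using sum_tuples_prod_list[where F = "\<lambda>_. Var" and us = "replicate m ()" and A = "{..<n}"] by simp
  also have "\<dots> = (\<Sum>js\<in>tuples {..<n} m. prod_list (map Var js))"
  proof (rule sum.cong)
    fix js assume "js \<in> tuples {..<n} m"
    then have "map fst (zip js (replicate m ())) = js" by (simp add: tuples_def)
    then have "map Var js = map (\<lambda>(j, u). Var j) (zip js (replicate m ()))"
      by (metis (mono_tags, lifting) map_map comp_def case_prod_beta' map_eq_conv)
    then show "(\<Prod>(j, u)\<leftarrow>zip js (replicate m ()). Var j) = prod_list (map Var js)" by simp
  qed simp
  finally have "mcoeff ((\<Sum>j<n. Var j) ^ m) A = of_nat (card {js \<in> tuples {..<n} m. mset js = A})"
    by (simp add: mcoeff_prod_list_Var sum.inter_filter[symmetric])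
  also have "{js \<in> tuples {..<n} m. mset js = A} = permutations_of_multiset A"
    using assms by (rule permutations_conv_tuples)
  finally have 1: "mcoeff ((\<Sum>j<n. Var j) ^ m) A = of_nat (card (permutations_of_multiset A))" .
  have "card (permutations_of_multiset A) * mfact n (count A) = fact m"
    using card_permutations_mfact[of A n] assms by (auto simp: msets_def)
  then have "of_nat (card (permutations_of_multiset A)) * of_nat (mfact n (count A)) = (fact m :: complex)"
    by (metis of_nat_fact of_nat_mult)
  moreover have "(of_nat (mfact n (count A)) :: complex) \<noteq> 0"
    by (metis mfact_pos of_nat_eq_0_iff less_numeral_extra(3))
  ultimately show ?thesis unfolding 1 by (simp add: field_simps)
qed

lemma norm_mcoeff_weight_le:
  assumes "d \<ge> 2" "k \<ge> 1" "T \<in> catalan d k" "i < n" and A: "A \<in> msets n ((d - 1) * k + 1)"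
    and "\<And>i \<beta>. i < n \<Longrightarrow> \<beta> \<in> mi n \<Longrightarrow> mdeg n \<beta> = d \<Longrightarrow> norm (Hc i \<beta>) \<le> L"
  shows "norm (mcoeff (weight n Hc T i) A)
    \<le> real n ^ (k - 1) * L ^ k * (fact ((d - 1) * k + 1) / real (mfact n (count A)))"
proof -
  have T: "dcat d T" "internal T = k" "T \<noteq> Nd []" using assms by (auto simp: catalan_def)
  have "norm (mcoeff (weight n Hc T i) A) \<le> Re (mcoeff (weight n (\<lambda>_ _. of_real L) T i) A)"
    using dominated_weight[OF assms(6) T(1) assms(4)] by (auto simp: dominated_def)
  also have "mcoeff (weight n (\<lambda>_ _. of_real L) T i) A
    = of_real L * (of_nat n * of_real L) ^ (k - 1) * (fact ((d - 1) * k + 1) / of_nat (mfact n (count A)))"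
    using weight_const[OF T(1) _ T(3)] assms(1) T(2) mcoeff_sum_Var_power[OF A] by simp
  also have "\<dots> = complex_of_real (L * (real n * L) ^ (k - 1) * (fact ((d - 1) * k + 1) / real (mfact n (count A))))"
    by simp
  also have "L * (real n * L) ^ (k - 1) = real n ^ (k - 1) * L ^ k"
    using assms(2) by (cases k) (auto simp: power_mult_distrib)
  finally show ?thesis by simp
qed

section \<open>Nilpotent Jacobians annihilate shuffle classes\<close>

text \<open>Entry \<open>(l, b)\<close> of a product of \<open>p\<close> matrices, the factors using
  successive blocks of \<open>d - 1\<close> letters of \<open>a\<close>: the power of the Jacobian
  with its arguments kept apart in order.\<close>

fun path_coeff :: "nat \<Rightarrow> nat \<Rightarrow> (nat \<Rightarrow> (nat \<Rightarrow> nat) \<Rightarrow> complex) \<Rightarrow> nat \<Rightarrow> nat \<Rightarrow> nat \<Rightarrow> nat list \<Rightarrow> complex" where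
  "path_coeff n d Hc 0 l b a = (if l = b then 1 else 0)"
| "path_coeff n d Hc (Suc p) l b a = (\<Sum>l'<n. Hc l (count (mset (l' # take (d - 1) a)))
     * path_coeff n d Hc p l' b (drop (d - 1) a))"

text \<open>Differentiating a monomial divided by \<alpha>! in direction \<open>j\<close> lowers one
  exponent and keeps the normalisation. In terms of words one letter \<open>j\<close> is removed and
  \<open>1/d!\<close> turns into \<open>1/(d-1)!\<close>.\<close>

lemma mps_of_JH:
  assumes "d \<ge> 1" "j < n"
  shows "mps_of n (JH n d Hc i j) = cst (1 / fact (d - 1)) *
    (\<Sum>a\<in>tuples {..<n} (d - 1). cst (Hc i (count (mset (j # a)))) * prod_list (map Var a))"
proof (rule mps_eqI)
  fix A
  define c where "c = Hc i (count (add_mset j A))"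
  have cnt: "(count A)(j := count A j + 1) = count (add_mset j A)" by auto
  have "mcoeff (cst (1 / fact (d - 1)) *
      (\<Sum>a\<in>tuples {..<n} (d - 1). cst (Hc i (count (mset (j # a)))) * prod_list (map Var a))) A
    = 1 / fact (d - 1) * (\<Sum>a\<in>tuples {..<n} (d - 1). if mset a = A then c else 0)"
    unfolding mcoeff_cst_mult mcoeff_sum mcoeff_prod_list_Var
    by (intro arg_cong[of _ _ "(*) _"] sum.cong) (auto simp: c_def)
  also have "\<dots> = 1 / fact (d - 1) * (of_nat (card {a \<in> tuples {..<n} (d - 1). mset a = A}) * c)"
    by (simp add: sum.inter_filter[symmetric])
  also have "\<dots> = mcoeff (mps_of n (JH n d Hc i j)) A"
  proof (cases "A \<in> msets n (d - 1)")
    case False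
    then have "{a \<in> tuples {..<n} (d - 1). mset a = A} = {}"
      by (auto simp: msets_conv_tuples)
    moreover have "mcoeff (mps_of n (JH n d Hc i j)) A = 0"
    proof (cases "set_mset A \<subseteq> {..<n}")
      case True
      then have "mdeg n ((count A)(j := count A j + 1)) \<noteq> d"
        unfolding cnt using mdeg_count[of "add_mset j A" n] False assms by (auto simp: msets_def)
      then show ?thesis by (simp add: mcoeff_mps_of JH_def sderiv_def Hpoly_def)
    qed (simp add: mcoeff_mps_of)
    ultimately show ?thesis by (metis card.empty mult_zero_left mult_zero_right of_nat_0)
  next
    case True
    then have A: "set_mset A \<subseteq> {..<n}" "size A = d - 1" by (auto simp: msets_def)
    have "mdeg n (count (add_mset j A)) = d" "count (add_mset j A) \<in> mi n"
      using mdeg_count[of "add_mset j A" n] count_mem_mi_iff[of "add_mset j A" n] A assms by auto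
    then have L: "mcoeff (mps_of n (JH n d Hc i j)) A
      = of_nat (count A j + 1) * (c / of_nat (mfact n (count (add_mset j A))))"
      using A(1) by (simp only: mcoeff_mps_of JH_def sderiv_def Hpoly_def cnt c_def if_True simp_thms)
    have "mfact n (count (add_mset j A)) = fact (count A j + 1) * (\<Prod>x\<in>{..<n} - {j}. fact (count (add_mset j A) x))"
      unfolding mfact_def using assms by (subst prod.remove[of _ j]) auto
    also have "(\<Prod>x\<in>{..<n} - {j}. fact (count (add_mset j A) x)) = (\<Prod>x\<in>{..<n} - {j}. fact (count A x))"
      by (rule prod.cong) auto
    also have "fact (count A j + 1) * \<dots> = (count A j + 1) * (fact (count A j) * (\<Prod>x\<in>{..<n} - {j}. fact (count A x)))"
      by (simp add: algebra_simps)
    also have "fact (count A j) * (\<Prod>x\<in>{..<n} - {j}. fact (count A x)) = mfact n (count A)"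
      unfolding mfact_def using assms by (subst prod.remove[of _ j, symmetric]) auto
    finally have mf: "mfact n (count (add_mset j A)) = (count A j + 1) * mfact n (count A)" .
    have "(of_nat (count A j + 1) :: complex) \<noteq> 0" by (metis add_is_0 of_nat_eq_0_iff one_neq_zero)
    then have L': "mcoeff (mps_of n (JH n d Hc i j)) A = c / of_nat (mfact n (count A))"
      unfolding L mf by (simp only: of_nat_mult) simp
    have "card (permutations_of_multiset A) * mfact n (count A) = fact (d - 1)"
      using card_permutations_mfact[OF A(1)] A(2) by simp
    then have "of_nat (card (permutations_of_multiset A)) * of_nat (mfact n (count A)) = (fact (d - 1) :: complex)"
      by (metis of_nat_fact of_nat_mult)
    moreover have "(of_nat (mfact n (count A)) :: complex) \<noteq> 0"
      by (metis mfact_pos of_nat_eq_0_iff less_numeral_extra(3))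
    ultimately show ?thesis
      unfolding L' permutations_conv_tuples[OF True] by (simp add: field_simps)
  qed
  finally show "mcoeff (mps_of n (JH n d Hc i j)) A = mcoeff (cst (1 / fact (d - 1)) *
      (\<Sum>a\<in>tuples {..<n} (d - 1). cst (Hc i (count (mset (j # a)))) * prod_list (map Var a))) A"
    by simp
qed

lemma mps_of_matmul: "mps_of n (matmul n X Y i j) = (\<Sum>l<n. mps_of n (X i l) * mps_of n (Y l j))"
  by (simp add: matmul_def mps_of_sum mps_of_smul)

text \<open>With \<open>F\<close> a monomial this computes \<open>(JH)\<^sup>p\<close>, with \<open>F\<close> a product of tree weights the weight of a
  comb; hence both have the same coefficients.\<close>

lemma path_coeff_step:
  assumes F: "\<And>a b. a \<in> tuples {..<n} (d - 1) \<Longrightarrow> b \<in> tuples {..<n} ((d - 1) * p) \<Longrightarrow> F (a @ b) = P a * Q b"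
  shows "(\<Sum>l'<n. (\<Sum>a\<in>tuples {..<n} (d - 1). cst (Hc l (count (mset (l' # a)))) * P a)
      * (\<Sum>b\<in>tuples {..<n} ((d - 1) * p). cst (path_coeff n d Hc p l' m b) * Q b))
    = (\<Sum>a\<in>tuples {..<n} ((d - 1) * Suc p). cst (path_coeff n d Hc (Suc p) l m a) * F a)"
    (is "?L = ?R")
proof -
  have "?L = (\<Sum>l'<n. \<Sum>a\<in>tuples {..<n} (d - 1). \<Sum>b\<in>tuples {..<n} ((d - 1) * p).
      cst (Hc l (count (mset (l' # a))) * path_coeff n d Hc p l' m b) * (P a * Q b))"
    by (simp add: sum_product cst_mult mult_ac)
  also have "\<dots> = (\<Sum>a\<in>tuples {..<n} (d - 1). \<Sum>b\<in>tuples {..<n} ((d - 1) * p). \<Sum>l'<n.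
      cst (Hc l (count (mset (l' # a))) * path_coeff n d Hc p l' m b) * (P a * Q b))"
    by (subst sum.swap, intro sum.cong refl) (rule sum.swap)
  also have "\<dots> = (\<Sum>a\<in>tuples {..<n} (d - 1). \<Sum>b\<in>tuples {..<n} ((d - 1) * p).
      cst (path_coeff n d Hc (Suc p) l m (a @ b)) * F (a @ b))"
  proof (intro sum.cong refl)
    fix a b assume *: "a \<in> tuples {..<n} (d - 1)" "b \<in> tuples {..<n} ((d - 1) * p)"
    then have "length a = d - 1" by (simp add: tuples_def)
    then have "path_coeff n d Hc (Suc p) l m (a @ b)
      = (\<Sum>l'<n. Hc l (count (mset (l' # a))) * path_coeff n d Hc p l' m b)" by simp
    then show "(\<Sum>l'<n. cst (Hc l (count (mset (l' # a))) * path_coeff n d Hc p l' m b) * (P a * Q b))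
      = cst (path_coeff n d Hc (Suc p) l m (a @ b)) * F (a @ b)"
      by (simp only: cst_sum sum_distrib_right F[OF *])
  qed
  also have "\<dots> = ?R" by (simp only: mult_Suc_right sum_tuples_append)
  finally show ?thesis .
qed

lemma mps_of_matpow_JH:
  assumes "d \<ge> 1" "l < n"
  shows "mps_of n (matpow n (JH n d Hc) p l b) = cst ((1 / fact (d - 1)) ^ p) *
    (\<Sum>a\<in>tuples {..<n} ((d - 1) * p). cst (path_coeff n d Hc p l b a) * prod_list (map Var a))"
  using assms(2)
proof (induction p arbitrary: l)
  case 0
  then show ?case by (simp add: matpow_def matid_def mps_of_sone mps_of_zero)
next
  case (Suc p)
  let ?c = "1 / fact (d - 1) :: complex"
  have "mps_of n (matpow n (JH n d Hc) (Suc p) l b)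
    = (\<Sum>l'<n. mps_of n (JH n d Hc l l') * mps_of n (matpow n (JH n d Hc) p l' b))"
    by (simp add: matpow_def mps_of_matmul)
  also have "\<dots> = (\<Sum>l'<n. cst (?c ^ Suc p) *
     ((\<Sum>a\<in>tuples {..<n} (d - 1). cst (Hc l (count (mset (l' # a)))) * prod_list (map Var a))
      * (\<Sum>b'\<in>tuples {..<n} ((d - 1) * p). cst (path_coeff n d Hc p l' b b') * prod_list (map Var b'))))"
    using Suc.IH by (intro sum.cong refl) (simp only: lessThan_iff mps_of_JH[OF assms(1)] power_Suc cst_mult mult_ac)
  also have "\<dots> = cst (?c ^ Suc p) *
    (\<Sum>a\<in>tuples {..<n} ((d - 1) * Suc p). cst (path_coeff n d Hc (Suc p) l b a) * prod_list (map Var a))"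
    unfolding sum_distrib_left[symmetric] by (subst path_coeff_step) simp_all
  finally show ?case .
qed

lemma weight_comb:
  assumes "d \<ge> 1" "\<forall>c\<in>set cs. c < d" "length xs = (d - 1) * length cs" "l < n"
  shows "weight n Hc (comb d cs xs B) l = (\<Sum>b<n. (\<Sum>a\<in>tuples {..<n} ((d - 1) * length cs).
    cst (path_coeff n d Hc (length cs) l b a) * fweight n Hc a xs) * weight n Hc B b)"
  using assms(2-)
proof (induction cs arbitrary: xs l)
  case Nil
  have "(\<Sum>b<n. (if l = b then 1 else 0) * weight n Hc B b) = (\<Sum>b<n. if l = b then weight n Hc B b else 0)"
    by (intro sum.cong) auto
  also have "\<dots> = weight n Hc B l" using Nil by simp
  finally have "(\<Sum>b<n. (if l = b then 1 else 0) * weight n Hc B b) = weight n Hc B l" .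
  moreover have "cst (if l = b then 1 else 0) = (if l = b then 1 else 0)" for b by simp
  ultimately show ?case using Nil by simp
next
  case (Cons c cs)
  define ys zs where "ys = take (d - 1) xs" and "zs = drop (d - 1) xs"
  define Y where "Y = comb d cs zs B"
  have c: "c < d" and len: "length ys = d - 1" "length zs = (d - 1) * length cs"
    using Cons.prems by (auto simp: ys_def zs_def)
  have tk: "take c xs = take c ys" using c by (auto simp: ys_def min_def)
  have dd: "d = c + Suc (d - 1 - c)" "d - 1 = c + (d - 1 - c)" using c by auto
  have lens: "length (take c ys) = c" "length (drop c ys) = d - 1 - c" using len c by auto
  let ?us = "take c ys @ Y # drop c ys"
  have lu: "length ?us = d" using lens dd(1) by simp
  have "weight n Hc (comb d (c # cs) xs B) l = weight n Hc (Nd ?us) l"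
    by (simp add: tk Y_def zs_def ys_def)
  also have "\<dots> = (\<Sum>js\<in>tuples {..<n} d. cst (Hc l (count (mset js))) * fweight n Hc js ?us)"
    by (subst weight_node) (simp_all only: lu, simp)
  also have "\<dots> = (\<Sum>a1\<in>tuples {..<n} c. \<Sum>l'<n. \<Sum>a2\<in>tuples {..<n} (d - 1 - c).
      cst (Hc l (count (mset (a1 @ l' # a2)))) * fweight n Hc (a1 @ l' # a2) ?us)"
    by (subst dd(1)) (simp only: sum_tuples_append sum_tuples_Suc)
  \<comment> \<open>The coefficient depends only on the content of the word, so the label of the
    spine child can be moved to the front. This is why the direction \<open>c\<close> of the path
    has no influence on \<open>path_coeff\<close>.\<close>
  also have "\<dots> = (\<Sum>a1\<in>tuples {..<n} c. \<Sum>l'<n. \<Sum>a2\<in>tuples {..<n} (d - 1 - c).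
      cst (Hc l (count (mset (l' # a1 @ a2)))) * fweight n Hc (a1 @ a2) ys * weight n Hc Y l')"
  proof (intro sum.cong refl)
    fix a1 a2 l' assume "a1 \<in> tuples {..<n} c" "a2 \<in> tuples {..<n} (d - 1 - c)"
    then have la: "length a1 = length (take c ys)" using lens by (simp add: tuples_def)
    have "fweight n Hc (a1 @ l' # a2) ?us = fweight n Hc a1 (take c ys) * fweight n Hc a2 (drop c ys) * weight n Hc Y l'"
      by (simp add: fweight_append[OF la] mult_ac)
    also have "fweight n Hc a1 (take c ys) * fweight n Hc a2 (drop c ys) = fweight n Hc (a1 @ a2) ys"
      by (metis fweight_append[OF la] append_take_drop_id)
    finally show "cst (Hc l (count (mset (a1 @ l' # a2)))) * fweight n Hc (a1 @ l' # a2) ?us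
      = cst (Hc l (count (mset (l' # a1 @ a2)))) * fweight n Hc (a1 @ a2) ys * weight n Hc Y l'"
      by (simp add: mult.assoc)
  qed
  also have "\<dots> = (\<Sum>l'<n. (\<Sum>a1\<in>tuples {..<n} c. \<Sum>a2\<in>tuples {..<n} (d - 1 - c).
      cst (Hc l (count (mset (l' # a1 @ a2)))) * fweight n Hc (a1 @ a2) ys * weight n Hc Y l'))"
    by (rule sum.swap)
  also have "\<dots> = (\<Sum>l'<n. (\<Sum>a\<in>tuples {..<n} (d - 1).
      cst (Hc l (count (mset (l' # a)))) * fweight n Hc a ys) * weight n Hc Y l')"
    by (subst dd(2)) (simp only: sum_tuples_append sum_distrib_right)
  also have "\<dots> = (\<Sum>l'<n. \<Sum>b<n. (\<Sum>a\<in>tuples {..<n} (d - 1).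
      cst (Hc l (count (mset (l' # a)))) * fweight n Hc a ys) *
      (\<Sum>a\<in>tuples {..<n} ((d - 1) * length cs). cst (path_coeff n d Hc (length cs) l' b a) * fweight n Hc a zs)
      * weight n Hc B b)"
  proof (intro sum.cong refl)
    fix l' assume "l' \<in> {..<n}"
    then have "weight n Hc Y l' = (\<Sum>b<n. (\<Sum>a\<in>tuples {..<n} ((d - 1) * length cs).
      cst (path_coeff n d Hc (length cs) l' b a) * fweight n Hc a zs) * weight n Hc B b)"
      unfolding Y_def using Cons len by (intro Cons.IH) auto
    then show "(\<Sum>a\<in>tuples {..<n} (d - 1).
      cst (Hc l (count (mset (l' # a)))) * fweight n Hc a ys) * weight n Hc Y l'
     = (\<Sum>b<n. (\<Sum>a\<in>tuples {..<n} (d - 1).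
      cst (Hc l (count (mset (l' # a)))) * fweight n Hc a ys) *
      (\<Sum>a\<in>tuples {..<n} ((d - 1) * length cs). cst (path_coeff n d Hc (length cs) l' b a) * fweight n Hc a zs)
      * weight n Hc B b)"
      by (simp only: sum_distrib_left[where A = "{..<n}"] mult.assoc)
  qed
  also have "\<dots> = (\<Sum>b<n. \<Sum>l'<n. (\<Sum>a\<in>tuples {..<n} (d - 1).
      cst (Hc l (count (mset (l' # a)))) * fweight n Hc a ys) *
      (\<Sum>a\<in>tuples {..<n} ((d - 1) * length cs). cst (path_coeff n d Hc (length cs) l' b a) * fweight n Hc a zs)
      * weight n Hc B b)"
    by (rule sum.swap)
  also have "\<dots> = (\<Sum>b<n. (\<Sum>a\<in>tuples {..<n} ((d - 1) * Suc (length cs)).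
      cst (path_coeff n d Hc (Suc (length cs)) l b a) * fweight n Hc a xs) * weight n Hc B b)"
  proof (intro sum.cong refl)
    fix b
    have F: "fweight n Hc (a @ a') xs = fweight n Hc a ys * fweight n Hc a' zs" if "a \<in> tuples {..<n} (d - 1)" for a a'
    proof -
      have "length a = length ys" using that len by (simp add: tuples_def)
      then show ?thesis by (metis fweight_append append_take_drop_id ys_def zs_def)
    qed
    show "(\<Sum>l'<n. (\<Sum>a\<in>tuples {..<n} (d - 1).
      cst (Hc l (count (mset (l' # a)))) * fweight n Hc a ys) *
      (\<Sum>a\<in>tuples {..<n} ((d - 1) * length cs). cst (path_coeff n d Hc (length cs) l' b a) * fweight n Hc a zs)
      * weight n Hc B b) = (\<Sum>a\<in>tuples {..<n} ((d - 1) * Suc (length cs)).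
      cst (path_coeff n d Hc (Suc (length cs)) l b a) * fweight n Hc a xs) * weight n Hc B b"
      unfolding sum_distrib_right[symmetric] by (subst path_coeff_step[where F = "\<lambda>a. fweight n Hc a xs" and P = "\<lambda>a. fweight n Hc a ys" and Q = "\<lambda>a. fweight n Hc a zs"])
        (simp_all only: F)
  qed
  finally show ?case by simp
qed

text \<open>All rearrangements of a word give the same monomial, so nilpotency controls only the sum
  of their coefficients, not each \<open>path_coeff\<close> separately.\<close>

lemma sum_path_coeff_eq_0:
  assumes "d \<ge> 1" "JH_nilp n d Hc p" "l < n" "b < n"
  shows "(\<Sum>a\<in>{a \<in> tuples {..<n} ((d - 1) * p). mset a = A}. path_coeff n d Hc p l b a) = 0"
proof -
  have "mps_of n (matpow n (JH n d Hc) p l b) = mps_of n (\<lambda>_. 0)"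
    using assms by (intro mps_of_eqI) (auto simp: JH_nilp_def)
  then have "mcoeff (mps_of n (matpow n (JH n d Hc) p l b)) A = 0" by (simp add: mps_of_zero)
  then have "(\<Sum>a\<in>tuples {..<n} ((d - 1) * p). if mset a = A then path_coeff n d Hc p l b a else 0) = 0"
    by (simp add: mps_of_matpow_JH[OF assms(1,3)] mcoeff_prod_list_Var if_distrib[of "\<lambda>x. _ * x"] cong: if_cong)
  then show ?thesis by (simp add: sum.inter_filter)
qed

text \<open>A product of weights depends only on the multiset of pairs of label and tree; permuting
  the labels is thus compensated by permuting the trees, over which the sum runs anyway.\<close>

lemma sum_rearrangements_mset_cong:
  assumes "mset a = mset a'" "length a = length ss"
  shows "(\<Sum>xs\<in>{xs. mset xs = mset ss}. fweight n Hc a xs) = (\<Sum>xs\<in>{xs. mset xs = mset ss}. fweight n Hc a' xs)"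
proof -
  let ?R = "{xs. mset xs = mset ss}"
  obtain \<pi> where \<pi>: "\<pi> permutes {..<length a'}" "permute_list \<pi> a' = a"
    using mset_eq_permutation[OF assms(1)] .
  have len: "length a' = length ss" using assms by (metis size_mset)
  have lenR: "length xs = length ss" if "xs \<in> ?R" for xs using that by (metis mem_Collect_eq size_mset)
  have finR: "finite ?R" using finite_permutations_of_multiset[of "mset ss"] by (simp add: permutations_of_multiset_def)
  have inv: "permute_list (inv \<pi>) (permute_list \<pi> xs) = xs" if "xs \<in> ?R" for xs
  proof -
    have "inv \<pi> permutes {..<length xs}" using permutes_inv[OF \<pi>(1)] lenR[OF that] len by simp
    then have "permute_list (inv \<pi>) (permute_list \<pi> xs) = permute_list (\<pi> \<circ> inv \<pi>) xs"
      by (simp add: permute_list_compose)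
    then show ?thesis using permutes_inv_o(1)[OF \<pi>(1)] by (simp add: permute_list_id)
  qed
  have "inj_on (permute_list \<pi>) ?R" using inv by (rule inj_on_inverseI)
  moreover have "permute_list \<pi> ` ?R \<subseteq> ?R"
  proof (rule image_subsetI)
    fix xs assume xs: "xs \<in> ?R"
    then have "\<pi> permutes {..<length xs}" using \<pi>(1) len lenR[OF xs] by metis
    then show "permute_list \<pi> xs \<in> ?R" using xs by simp
  qed
  ultimately have "bij_betw (permute_list \<pi>) ?R ?R"
    using finR by (simp add: bij_betw_def endo_inj_surj)
  then have "(\<Sum>xs\<in>?R. fweight n Hc a xs) = (\<Sum>xs\<in>?R. fweight n Hc a (permute_list \<pi> xs))"
    by (rule sum.reindex_bij_betw[symmetric])
  also have "\<dots> = (\<Sum>xs\<in>?R. fweight n Hc a' xs)"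
  proof (intro sum.cong refl)
    fix xs assume "xs \<in> ?R"
    then have l: "length a' = length xs" using lenR len by metis
    have "zip a (permute_list \<pi> xs) = permute_list \<pi> (zip a' xs)"
      unfolding \<pi>(2)[symmetric] using permute_list_zip[OF \<pi>(1) refl l] by simp
    then have "mset (zip a (permute_list \<pi> xs)) = mset (zip a' xs)"
      using \<pi>(1) l by (simp add: mset_permute_list)
    then show "fweight n Hc a (permute_list \<pi> xs) = fweight n Hc a' xs"
      unfolding fweight_def by (metis mset_map prod_mset_prod_list)
  qed
  finally show ?thesis .
qed

text \<open>Polarisation by grouping: among words \<open>a\<close> of equal content the sum over
  rearranged siblings is constant and factors out, leaving the vanishing sum of
  \<open>path_coeff\<close>.\<close>

lemma sum_weight_comb_eq_0:
  assumes "d \<ge> 1" "JH_nilp n d Hc (length cs)" "\<forall>c\<in>set cs. c < d" "length ss = (d - 1) * length cs" "l < n"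
  shows "(\<Sum>xs\<in>{xs. mset xs = mset ss}. weight n Hc (comb d cs xs B) l) = 0"
proof -
  let ?R = "{xs. mset xs = mset ss}" and ?t = "tuples {..<n} ((d - 1) * length cs)"
  have len: "length xs = (d - 1) * length cs" if "xs \<in> ?R" for xs
    using that assms(4) by (metis mem_Collect_eq size_mset)
  have "(\<Sum>xs\<in>?R. weight n Hc (comb d cs xs B) l)
    = (\<Sum>xs\<in>?R. \<Sum>b<n. \<Sum>a\<in>?t. cst (path_coeff n d Hc (length cs) l b a) * fweight n Hc a xs * weight n Hc B b)"
    using weight_comb[OF assms(1,3) len assms(5)] by (intro sum.cong refl) (simp add: sum_distrib_right)
  also have "\<dots> = (\<Sum>b<n. \<Sum>a\<in>?t. \<Sum>xs\<in>?R. cst (path_coeff n d Hc (length cs) l b a) * fweight n Hc a xs * weight n Hc B b)"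
    by (subst sum.swap, intro sum.cong refl) (rule sum.swap)
  also have "\<dots> = (\<Sum>b<n. (\<Sum>a\<in>?t. cst (path_coeff n d Hc (length cs) l b a) * (\<Sum>xs\<in>?R. fweight n Hc a xs)) * weight n Hc B b)"
    by (simp add: sum_distrib_left sum_distrib_right mult.assoc)
  also have "\<dots> = (\<Sum>b<n. 0 * weight n Hc B b)"
  proof (rule sum.cong[OF refl])
    fix b assume b: "b \<in> {..<n}"
    let ?f = "\<lambda>a. cst (path_coeff n d Hc (length cs) l b a) * (\<Sum>xs\<in>?R. fweight n Hc a xs)"
    have "sum ?f {a \<in> ?t. mset a = A} = 0" if A: "A \<in> mset ` ?t" for A
    proof -
      obtain a0 where a0: "a0 \<in> ?t" "A = mset a0" using A by blast
      have "sum ?f {a \<in> ?t. mset a = A}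
        = (\<Sum>a\<in>{a \<in> ?t. mset a = A}. cst (path_coeff n d Hc (length cs) l b a) * (\<Sum>xs\<in>?R. fweight n Hc a0 xs))"
      proof (rule sum.cong[OF refl])
        fix a assume "a \<in> {a \<in> ?t. mset a = A}"
        then have "(\<Sum>xs\<in>?R. fweight n Hc a xs) = (\<Sum>xs\<in>?R. fweight n Hc a0 xs)"
          using a0 assms(4) by (intro sum_rearrangements_mset_cong) (auto simp: tuples_def)
        then show "?f a = cst (path_coeff n d Hc (length cs) l b a) * (\<Sum>xs\<in>?R. fweight n Hc a0 xs)"
          by simp
      qed
      also have "\<dots> = cst (\<Sum>a\<in>{a \<in> ?t. mset a = A}. path_coeff n d Hc (length cs) l b a) * (\<Sum>xs\<in>?R. fweight n Hc a0 xs)"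
        by (simp only: cst_sum sum_distrib_right)
      also have "\<dots> = 0" using sum_path_coeff_eq_0[OF assms(1,2,5)] b by simp
      finally show ?thesis .
    qed
    then have "sum ?f ?t = 0" by (subst sum.image_gen[of _ _ mset]) auto
    then show "sum ?f ?t * weight n Hc B b = 0 * weight n Hc B b" by simp
  qed
  finally show ?thesis by simp
qed

lemma fweight_list_update:
  assumes "length js = length ts" "c < length ts"
  shows "fweight n Hc js (ts[c := Y])
    = fweight n Hc (take c js) (take c ts) * weight n Hc Y (js ! c) * fweight n Hc (drop (Suc c) js) (drop (Suc c) ts)"
proof -
  have "fweight n Hc js (ts[c := Y]) = fweight n Hc (take c js @ js ! c # drop (Suc c) js) (take c ts @ Y # drop (Suc c) ts)"
    using assms by (simp add: upd_conv_take_nth_drop id_take_nth_drop[symmetric])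
  also have "\<dots> = fweight n Hc (take c js) (take c ts) * fweight n Hc (js ! c # drop (Suc c) js) (Y # drop (Suc c) ts)"
    using assms by (intro fweight_append) simp
  finally show ?thesis by (simp add: mult.assoc)
qed

text \<open>The weight of a tree is linear in the weights of the subtree at a fixed position, so a
  relation valid for every root label of that subtree passes up to the whole tree.\<close>

lemma sum_weight_repl_eq_0:
  assumes "\<And>l. l < n \<Longrightarrow> (\<Sum>x\<in>I. weight n Hc (S x) l) = 0" "ispos T v" "i < n"
  shows "(\<Sum>x\<in>I. weight n Hc (repl T v (S x)) i) = 0"
  using assms(2,3)
proof (induction T v arbitrary: i rule: ispos.induct)
  case (1 T)
  then show ?case using assms(1) by simp
next
  case (2 ts c cs)
  have c: "c < length ts" "ispos (ts ! c) cs" using 2 by auto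
  then have ne: "ts[c := Y] \<noteq> []" for Y by auto
  have "(\<Sum>x\<in>I. weight n Hc (repl (Nd ts) (c # cs) (S x)) i)
    = (\<Sum>x\<in>I. \<Sum>js\<in>tuples {..<n} (length ts). cst (Hc i (count (mset js))) *
        fweight n Hc js (ts[c := repl (ts ! c) cs (S x)]))"
    using c by (simp add: weight_node[OF ne])
  also have "\<dots> = (\<Sum>js\<in>tuples {..<n} (length ts). \<Sum>x\<in>I. cst (Hc i (count (mset js))) *
        fweight n Hc js (ts[c := repl (ts ! c) cs (S x)]))"
    by (rule sum.swap)
  also have "\<dots> = 0"
  proof (rule sum.neutral, rule ballI)
    fix js assume js: "js \<in> tuples {..<n} (length ts)"
    then have l: "length js = length ts" "js ! c < n" using c by (auto simp: tuples_def subset_iff)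
    let ?a = "cst (Hc i (count (mset js))) * fweight n Hc (take c js) (take c ts)" and ?b = "fweight n Hc (drop (Suc c) js) (drop (Suc c) ts)"
    have "(\<Sum>x\<in>I. cst (Hc i (count (mset js))) * fweight n Hc js (ts[c := repl (ts ! c) cs (S x)]))
      = ?a * (\<Sum>x\<in>I. weight n Hc (repl (ts ! c) cs (S x)) (js ! c)) * ?b"
      by (simp add: fweight_list_update[OF l(1) c(1)] sum_distrib_left sum_distrib_right mult.assoc)
    also have "\<dots> = 0" using 2(1)[OF c(2) l(2)] by simp
    finally show "(\<Sum>x\<in>I. cst (Hc i (count (mset js))) * fweight n Hc js (ts[c := repl (ts ! c) cs (S x)])) = 0" .
  qed
  finally show ?case .
qed

lemma sum_weight_shuffle_class_eq_0:
  assumes "d \<ge> 1" "JH_nilp n d Hc p" "S \<in> shuffle_classes d k p" "i < n"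
  shows "(\<Sum>T\<in>S. weight n Hc T i) = 0"
proof -
  obtain T v cs where *: "S = shuffle_class d T v cs" "T \<in> catalan d k" "is_path T v cs" "length cs = p"
    using assms(3) by (auto simp: shuffle_classes_def)
  interpret comb_path d k T v cs using * by unfold_locales
  show ?thesis
    unfolding *(1) shuffle_class_conv sum.reindex[OF inj_on_comb] comp_def
    using assms *(4) cs_less length_sibs
    by (intro sum_weight_repl_eq_0 pos(1) sum_weight_comb_eq_0) auto
qed

lemma shuffle_classes_subset: "S \<in> shuffle_classes d k p \<Longrightarrow> S \<subseteq> catalan d k"
proof -
  assume "S \<in> shuffle_classes d k p"
  then obtain T v cs where *: "S = shuffle_class d T v cs" "T \<in> catalan d k" "is_path T v cs"
    by (auto simp: shuffle_classes_def)
  interpret comb_path d k T v cs using * by unfold_locales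
  show ?thesis using shuffle_class_subset *(1) by simp
qed

section \<open>Existence of the inverse\<close>

text \<open>Telescoping by \<open>f P - g Q = (f - g) P + g (P - Q)\<close>: one factor carries the
  difference, and each of the others raises the order by one.\<close>

lemma mord_prod_list_diff:
  assumes "\<And>j. j \<in> set js \<Longrightarrow> mord m (F j - G j) \<and> mord 1 (F j) \<and> mord 1 (G j)"
  shows "mord (m + (length js - 1)) (prod_list (map F js) - prod_list (map G js))"
  using assms
proof (induction js)
  case (Cons j js)
  have "mord (m + length (map F js)) ((F j - G j) * prod_list (map F js))"
    using Cons.prems by (intro mord_mult mord_prod_list) auto
  moreover have "mord (m + length js) (G j * (prod_list (map F js) - prod_list (map G js)))"
  \<comment> \<open>For empty \<open>js\<close> the difference is 0 and the truncated
    \<open>length js - 1\<close> does no harm; otherwise the factor \<open>G j\<close> makes up for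
    the missing order.\<close>
  proof (cases "js = []")
    case False
    have "mord (1 + (m + (length js - 1))) (G j * (prod_list (map F js) - prod_list (map G js)))"
      using Cons by (intro mord_mult) auto
    then show ?thesis using False by (rule_tac mord_mono) (auto simp: Suc_le_eq)
  qed simp
  ultimately have "mord (m + length js) ((F j - G j) * prod_list (map F js) + G j * (prod_list (map F js) - prod_list (map G js)))"
    by (intro mord_add) auto
  then show ?case by (simp add: algebra_simps)
qed simp

text \<open>The map is a contraction for the filtration: \<open>d >= 2\<close> leaves at least one
  further factor of order 1 beside the difference.\<close>

lemma mord_Hlist_diff:
  assumes "d \<ge> 2" "\<And>j. j < n \<Longrightarrow> mord m (F j - G j) \<and> mord 1 (F j) \<and> mord 1 (G j)"
  shows "mord (Suc m) (Hlist n d Hc F i - Hlist n d Hc G i)"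
proof -
  have "Hlist n d Hc F i - Hlist n d Hc G i = cst (1 / fact d) * (\<Sum>js\<in>tuples {..<n} d.
    cst (Hc i (count (mset js))) * (prod_list (map F js) - prod_list (map G js)))"
    by (simp only: Hlist_def right_diff_distrib sum_subtractf)
  moreover have "mord (Suc m) (prod_list (map F js) - prod_list (map G js))" if "js \<in> tuples {..<n} d" for js
  proof -
    have "mord (m + (length js - 1)) (prod_list (map F js) - prod_list (map G js))"
      using that assms(2) by (intro mord_prod_list_diff) (auto simp: tuples_def)
    then show ?thesis using assms(1) that by (rule_tac mord_mono) (auto simp: tuples_def)
  qed
  ultimately show ?thesis by (auto intro!: mord_cst_mult mord_sum)
qed

primrec inverse_approx :: "nat \<Rightarrow> nat \<Rightarrow> (nat \<Rightarrow> (nat \<Rightarrow> nat) \<Rightarrow> complex) \<Rightarrow> nat \<Rightarrow> nat \<Rightarrow> fps_n" where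
  "inverse_approx n d Hc 0 = (\<lambda>i \<alpha>. 0)"
| "inverse_approx n d Hc (Suc h) = (\<lambda>i \<alpha>. (if \<alpha> = unitv i then 1 else 0) + Hcomp n d Hc (inverse_approx n d Hc h) i \<alpha>)"

text \<open>Sharpness asks for an actual inverse. It is the limit of the iterates of
  \<open>G -> X + H(G)\<close> from 0.\<close>

lemma ex_inverse:
  assumes "d \<ge> 2"
  shows "\<exists>g. is_inverse n d Hc g"
proof -
  define G where "G h i = mps_of n (inverse_approx n d Hc h i)" for h i
  \<comment> \<open>The \<open>h\<close>-th iterate is final in all degrees up to \<open>h\<close>,
    so the coefficient of \<alpha> can be read off the iterate whose index is the degree of
    \<alpha>.\<close>
  define g where "g i \<alpha> = inverse_approx n d Hc (mdeg n \<alpha>) i \<alpha>" for i \<alpha>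
  define X where "X i = mps_of n (g i)" for i
  have G0: "G 0 i = 0" for i by (simp add: G_def mps_of_zero)
  have GSuc: "G (Suc h) i = Var i + Hlist n d Hc (G h) i" if "i < n" for h i
    unfolding G_def inverse_approx.simps mps_of_add mps_of_Hcomp using mps_of_unitv[OF that] by simp
  have H1: "mord 1 (Hlist n d Hc F i)" if "\<And>j. j < n \<Longrightarrow> mord 1 (F j)" for F i
  proof -
    have "prod_list (map (\<lambda>_. 0) js) = (0 :: mps)" if "js \<in> tuples {..<n} d" for js
      using that assms by (cases js) (auto simp: tuples_def)
    then have "Hlist n d Hc (\<lambda>_. 0) i = 0" by (simp add: Hlist_def)
    moreover have "mord (Suc 1) (Hlist n d Hc F i - Hlist n d Hc (\<lambda>_. 0) i)"
      using that by (intro mord_Hlist_diff[OF assms]) auto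
    ultimately show ?thesis by (auto intro: mord_mono)
  qed
  have G1: "mord 1 (G h i)" if "i < n" for h i
    using that
  proof (induction h arbitrary: i)
    case (Suc h)
    have "mord 1 (Var i)" by (auto simp: mord_def mcoeff_Var)
    then show ?case unfolding GSuc[OF Suc.prems] using Suc.IH by (intro mord_add H1) auto
  qed (simp add: G0)
  have step: "mord (Suc h) (G (Suc h) i - G h i)" if "i < n" for h i
    using that
  proof (induction h arbitrary: i)
    case 0
    then show ?case using G1[of i "Suc 0"] by (simp add: G0)
  next
    case (Suc h)
    have "mord (Suc (Suc h)) (Hlist n d Hc (G (Suc h)) i - Hlist n d Hc (G h) i)"
      using Suc.IH G1 by (intro mord_Hlist_diff[OF assms]) auto
    then show ?case unfolding GSuc[OF Suc.prems] by simp
  qed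
  have stable: "mord (Suc h) (G (h + q) i - G h i)" if "i < n" for h q i
  proof (induction q)
    case (Suc q)
    have "mord (Suc h) (G (Suc (h + q)) i - G (h + q) i)"
      using step[OF that] by (rule mord_mono) simp
    from mord_add[OF this Suc] show ?case by simp
  qed simp
  have XG: "mord (Suc h) (X i - G h i)" if "i < n" for h i
    unfolding mord_def
  proof (intro allI impI)
    fix A :: "nat multiset" assume "size A < Suc h"
    then obtain q where q: "h = size A + q" using le_Suc_ex less_Suc_eq_le by blast
    have "mcoeff (X i) A = mcoeff (G (size A) i) A"
      by (auto simp: X_def G_def g_def mcoeff_mps_of mdeg_count)
    moreover have "mcoeff (G (size A + q) i - G (size A) i) A = 0"
      using stable[OF that, of "size A" q] unfolding mord_def by blast
    ultimately show "mcoeff (X i - G h i) A = 0" using q by simp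
  qed
  have X1: "mord 1 (X i)" if "i < n" for i using XG[OF that, of 0] by (simp add: G0)
  have "X i = Var i + Hlist n d Hc X i" if "i < n" for i
  proof (rule mord_eqI)
    fix m
    have 1: "mord (Suc (Suc m)) (X i - G (Suc m) i)" by (rule XG[OF that])
    have 2: "mord (Suc (Suc m)) (Hlist n d Hc X i - Hlist n d Hc (G m) i)"
      using XG X1 G1 by (intro mord_Hlist_diff[OF assms]) auto
    from mord_diff[OF 1 2] have "mord (Suc (Suc m)) (X i - (Var i + Hlist n d Hc X i))"
      unfolding GSuc[OF that] by (simp add: algebra_simps)
    then show "mord m (X i - (Var i + Hlist n d Hc X i))" by (rule mord_mono) simp
  qed
  then have "is_inverse n d Hc g" using X1 by (simp add: is_inverse_iff X_def[abs_def])
  then show ?thesis by blast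
qed

section \<open>The bounds\<close>

lemma finite_Lmax_set: "finite {cmod (Hc i \<beta>) | i \<beta>. i < n \<and> \<beta> \<in> mi n \<and> mdeg n \<beta> = d}"
proof -
  have "{cmod (Hc i \<beta>) | i \<beta>. i < n \<and> \<beta> \<in> mi n \<and> mdeg n \<beta> = d}
    = (\<lambda>(i, \<beta>). cmod (Hc i \<beta>)) ` ({..<n} \<times> {\<beta> \<in> mi n. mdeg n \<beta> = d})"
    by (auto simp: image_iff)
  then show ?thesis by (simp add: mi_conv_msets)
qed

lemma norm_le_Lmax: "i < n \<Longrightarrow> \<beta> \<in> mi n \<Longrightarrow> mdeg n \<beta> = d \<Longrightarrow> norm (Hc i \<beta>) \<le> Lmax n d Hc"
  unfolding Lmax_def by (rule Max_ge[OF finite_Lmax_set]) blast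

text \<open>The bound is the number of trees times \<open>(1/d!)^k\<close> times the majorant that
  all these trees share.\<close>

lemma gbound_conv:
  assumes "d \<ge> 1" "A \<in> msets n m"
  shows "gbound d n k (count A) L = real (card (catalan d k)) *
    ((1 / fact d) ^ k * (real n ^ (k - 1) * L ^ k * (fact m / real (mfact n (count A)))))"
proof -
  have "mdeg n (count A) = m" using assms(2) mdeg_count by (auto simp: msets_def)
  then show ?thesis
    unfolding gbound_def card_catalan[OF assms(1)] by (simp add: power_one_over mult_ac)
qed

text \<open>Common source of the general bound, with \<open>\<psi> = 1\<close>, and of the nilpotent
  one, with \<open>\<psi> = \<phi> - 1\<close>: since the majorant is the same for all trees, only
  the mean of the absolute values of \<psi> remains.\<close>

lemma norm_weighted_sum_le:
  fixes \<psi> :: "ptree \<Rightarrow> real"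
  assumes "d \<ge> 2" "k \<ge> 1" "i < n" "A \<in> msets n ((d - 1) * k + 1)"
  shows "norm (\<Sum>T\<in>catalan d k. of_real (\<psi> T) * ((1 / fact d) ^ k * mcoeff (weight n Hc T i) A))
    \<le> gbound d n k (count A) (Lmax n d Hc) * norm1 d k \<psi>"
proof -
  let ?b = "real n ^ (k - 1) * Lmax n d Hc ^ k * (fact ((d - 1) * k + 1) / real (mfact n (count A)))"
  have d1: "d \<ge> 1" using assms by simp
  have "norm (\<Sum>T\<in>catalan d k. of_real (\<psi> T) * ((1 / fact d) ^ k * mcoeff (weight n Hc T i) A))
    \<le> (\<Sum>T\<in>catalan d k. \<bar>\<psi> T\<bar> * ((1 / fact d) ^ k * norm (mcoeff (weight n Hc T i) A)))"
    by (rule order_trans[OF norm_sum]) (simp add: norm_mult norm_power norm_divide)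
  also have "\<dots> \<le> (\<Sum>T\<in>catalan d k. \<bar>\<psi> T\<bar> * ((1 / fact d) ^ k * ?b))"
    using assms norm_le_Lmax by (intro sum_mono mult_left_mono norm_mcoeff_weight_le) auto
  also have "\<dots> = (\<Sum>T\<in>catalan d k. \<bar>\<psi> T\<bar>) * ((1 / fact d) ^ k * ?b)"
    by (simp only: sum_distrib_right)
  also have "\<dots> = gbound d n k (count A) (Lmax n d Hc) * norm1 d k \<psi>"
    unfolding gbound_conv[OF d1 assms(4)] norm1_def using card_catalan_pos[OF d1, of k] by simp
  finally show ?thesis .
qed

lemma sum_shuffle_span_weight_eq_0:
  assumes "d \<ge> 1" "JH_nilp n d Hc p" "\<phi> \<in> shuffle_span d k p" "i < n"
  shows "(\<Sum>T\<in>catalan d k. of_real (\<phi> T) * mcoeff (weight n Hc T i) A) = 0"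
proof -
  obtain F c where F: "F \<subseteq> shuffle_classes d k p" and \<phi>: "\<phi> = (\<lambda>T. \<Sum>S\<in>F. c S * indicator S T)"
    using assms(3) by (auto simp: shuffle_span_def)
  let ?w = "\<lambda>T. mcoeff (weight n Hc T i) A"
  have "(\<Sum>T\<in>catalan d k. of_real (\<phi> T) * ?w T)
    = (\<Sum>T\<in>catalan d k. \<Sum>S\<in>F. of_real (c S) * (of_real (indicator S T) * ?w T))"
    by (simp add: \<phi> sum_distrib_right mult.assoc)
  also have "\<dots> = (\<Sum>S\<in>F. of_real (c S) * (\<Sum>T\<in>catalan d k. of_real (indicator S T) * ?w T))"
    by (subst sum.swap) (simp add: sum_distrib_left)
  also have "\<dots> = (\<Sum>S\<in>F. of_real (c S) * 0)"
  proof (rule sum.cong[OF refl])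
    fix S assume "S \<in> F"
    then have S: "S \<in> shuffle_classes d k p" "S \<subseteq> catalan d k" using F shuffle_classes_subset by blast+
    have "(\<Sum>T\<in>catalan d k. of_real (indicator S T) * ?w T) = (\<Sum>T\<in>S. of_real (indicator S T) * ?w T)"
      using S assms(1) by (intro sum.mono_neutral_right) (auto simp: indicator_def)
    also have "\<dots> = mcoeff (\<Sum>T\<in>S. weight n Hc T i) A" by (simp add: indicator_def)
    also have "\<dots> = 0" using sum_weight_shuffle_class_eq_0[OF assms(1,2) S(1) assms(4)] by simp
    finally show "of_real (c S) * (\<Sum>T\<in>catalan d k. of_real (indicator S T) * ?w T) = of_real (c S) * 0" by simp
  qed
  finally show ?thesis by simp
qed

lemma norm_inverse_le:
  assumes "d \<ge> 2" "is_inverse n d Hc g" "i < n" "k \<ge> 1" "\<alpha> \<in> mi n" "mdeg n \<alpha> = (d - 1) * k + 1"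
  shows "cmod (g i \<alpha>) \<le> gbound d n k \<alpha> (Lmax n d Hc)"
proof -
  obtain A where A: "\<alpha> = count A" "set_mset A \<subseteq> {..<n}" using mi_imp_count assms(5) by blast
  then have m: "A \<in> msets n ((d - 1) * k + 1)" using assms(6) mdeg_count by (simp add: msets_def)
  have "g i \<alpha> = (\<Sum>T\<in>catalan d k. of_real 1 * ((1 / fact d) ^ k * mcoeff (weight n Hc T i) A))"
    using inverse_conv_catalan[OF assms(1-3) A(2), of k] m A by (simp add: msets_def)
  then have "cmod (g i \<alpha>) \<le> gbound d n k \<alpha> (Lmax n d Hc) * norm1 d k (\<lambda>_. 1)"
    using norm_weighted_sum_le[OF assms(1,4,3) m, of "\<lambda>_. 1" Hc] A by simp
  moreover have "norm1 d k (\<lambda>_. 1) = 1"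
    using card_catalan_pos[of d k] assms(1) by (auto simp: norm1_def)
  ultimately show ?thesis by simp
qed

lemma norm_inverse_nilpotent_le:
  assumes "d \<ge> 2" "is_inverse n d Hc g" "JH_nilp n d Hc p" "i < n" "k \<ge> 1" "\<alpha> \<in> mi n"
    "mdeg n \<alpha> = (d - 1) * k + 1" "\<phi> \<in> shuffle_span d k p"
  shows "cmod (g i \<alpha>) \<le> gbound d n k \<alpha> (Lmax n d Hc) * norm1 d k (\<lambda>T. \<phi> T - 1)"
proof -
  obtain A where A: "\<alpha> = count A" "set_mset A \<subseteq> {..<n}" using mi_imp_count assms(6) by blast
  then have m: "A \<in> msets n ((d - 1) * k + 1)" using assms(7) mdeg_count by (simp add: msets_def)
  let ?w = "\<lambda>T. mcoeff (weight n Hc T i) A"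
  have "(\<Sum>T\<in>catalan d k. of_real (\<phi> T - 1) * ((1 / fact d) ^ k * ?w T))
    = (1 / fact d) ^ k * (\<Sum>T\<in>catalan d k. of_real (\<phi> T) * ?w T) - (\<Sum>T\<in>catalan d k. (1 / fact d) ^ k * ?w T)"
    by (simp add: sum_distrib_left sum_subtractf[symmetric] algebra_simps)
  also have "(\<Sum>T\<in>catalan d k. of_real (\<phi> T) * ?w T) = 0"
    using assms by (intro sum_shuffle_span_weight_eq_0) auto
  also have "(\<Sum>T\<in>catalan d k. (1 / fact d) ^ k * ?w T) = g i \<alpha>"
    using inverse_conv_catalan[OF assms(1,2,4) A(2), of k] m A by (simp add: msets_def)
  finally have "cmod (g i \<alpha>) = norm (\<Sum>T\<in>catalan d k. of_real (\<phi> T - 1) * ((1 / fact d) ^ k * ?w T))" by simp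
  then show ?thesis
    using norm_weighted_sum_le[OF assms(1,5,4) m, of "\<lambda>T. \<phi> T - 1" Hc] A by simp
qed

lemma sharp_inverse:
  assumes "d \<ge> 2" "n \<ge> 1"
  shows "\<exists>Hc g. is_inverse n d Hc g \<and> Lmax n d Hc > 0 \<and>
      (\<forall>i<n. \<forall>k\<ge>1. \<forall>\<alpha>\<in>mi n. mdeg n \<alpha> = (d - 1) * k + 1 \<longrightarrow>
         cmod (g i \<alpha>) = gbound d n k \<alpha> (Lmax n d Hc))"
proof -
  \<comment> \<open>With all coefficients 1 every tree has the same nonnegative weight, equal to its
    majorant, and nothing cancels.\<close>
  define Hc :: "nat \<Rightarrow> (nat \<Rightarrow> nat) \<Rightarrow> complex" where "Hc = (\<lambda>_ _. 1)"
  have d1: "d \<ge> 1" using assms by simp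
  obtain g where g: "is_inverse n d Hc g" using ex_inverse[OF assms(1)] by blast
  \<comment> \<open>A witness that the set under the maximum in \<open>Lmax\<close> is not
    empty.\<close>
  have "replicate_mset d 0 \<in> msets n d"
    using assms by (auto simp: msets_def in_replicate_mset)
  then have "{\<beta> \<in> mi n. mdeg n \<beta> = d} \<noteq> {}" unfolding mi_conv_msets by blast
  then have "{cmod (Hc i \<beta>) | i \<beta>. i < n \<and> \<beta> \<in> mi n \<and> mdeg n \<beta> = d} = {1}"
    using assms by (auto simp: Hc_def intro!: exI[of _ 0])
  then have L: "Lmax n d Hc = 1" by (simp add: Lmax_def)
  have "cmod (g i \<alpha>) = gbound d n k \<alpha> 1"
    if h: "i < n" "k \<ge> 1" "\<alpha> \<in> mi n" "mdeg n \<alpha> = (d - 1) * k + 1" for i k \<alpha>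
  proof -
    obtain A where A: "\<alpha> = count A" "set_mset A \<subseteq> {..<n}" using mi_imp_count[OF h(3)] by blast
    then have m: "A \<in> msets n ((d - 1) * k + 1)" using h mdeg_count by (simp add: msets_def)
    let ?b = "real n ^ (k - 1) * (fact ((d - 1) * k + 1) / real (mfact n (count A)))"
    have w: "mcoeff (weight n Hc T i) A = of_real ?b" if T: "T \<in> catalan d k" for T
    proof -
      have T': "dcat d T" "internal T = k" "T \<noteq> Nd []" using T \<open>k \<ge> 1\<close> by (auto simp: catalan_def)
      show ?thesis
        unfolding Hc_def using weight_const[OF T'(1) _ T'(3), of n 1 i] assms(1) T'(2) mcoeff_sum_Var_power[OF m]
        by simp
    qed
    have "g i \<alpha> = (\<Sum>T\<in>catalan d k. (1 / fact d) ^ k * of_real ?b)"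
      using inverse_conv_catalan[OF assms(1) g h(1) A(2), of k] m A w by (simp add: msets_def)
    also have "\<dots> = of_real (real (card (catalan d k)) * ((1 / fact d) ^ k * ?b))"
      by simp
    finally have "cmod (g i \<alpha>) = \<bar>real (card (catalan d k)) * ((1 / fact d) ^ k * ?b)\<bar>"
      by (simp only: norm_of_real)
    also have "\<dots> = real (card (catalan d k)) * ((1 / fact d) ^ k * ?b)"
      by (rule abs_of_nonneg) simp
    also have "\<dots> = gbound d n k \<alpha> 1"
      unfolding A(1) gbound_conv[OF d1 m] by simp
    finally show ?thesis .
  qed
  then show ?thesis using g L by (intro exI[of _ Hc] exI[of _ g]) simp
qed

lemma norm_inverse_nilpotent_exp_le:
  assumes "d \<ge> 2"
  shows "\<exists>C c. C > 0 \<and> c > 0 \<and> (\<exists>K. \<forall>k\<ge>K.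
      \<forall>n\<ge>1. \<forall>Hc g. is_inverse n d Hc g \<and> JH_nilp n d Hc p \<longrightarrow>
        (\<forall>i<n. \<forall>\<alpha>\<in>mi n. mdeg n \<alpha> = (d - 1) * k + 1 \<longrightarrow>
           cmod (g i \<alpha>) \<le> gbound d n k \<alpha> (Lmax n d Hc) * (C * exp (- c * real k))))"
proof (cases "p = 0")
  case True
  \<comment> \<open>The zeroth matrix power is the identity, so \<open>p = 0\<close> is vacuous. It
    has to be split off because the comb would degenerate to a leaf, which no tree avoids.\<close>
  have "\<not> JH_nilp n d Hc p" if "n \<ge> 1" for n Hc
  proof -
    have "(\<lambda>_. 0) \<in> mi n" by (simp add: mi_def)
    moreover have "matpow n (JH n d Hc) 0 0 0 (\<lambda>_. 0) = 1" by (simp add: matpow_def matid_def sone_def)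
    ultimately show ?thesis using that True by (auto simp: JH_nilp_def intro!: exI[of _ 0] bexI[of _ "\<lambda>_. 0"])
  qed
  then show ?thesis by (intro exI[of _ 1]) auto
next
  case False
  have d1: "d \<ge> 1" using assms by simp
  have "left_comb d p \<noteq> Nd []" using False by (cases p) auto
  \<comment> \<open>The forbidden tree is determined by \<open>d\<close> and \<open>p\<close>, hence
    so are the constants.\<close>
  then obtain C c where C: "C > 0" "c > 0" and
    few: "\<And>k. real (card {T \<in> catalan d k. \<not> has_subtree (left_comb d p) T})
           \<le> C * exp (- c * real k) * real (card (catalan d k))"
    using avoiding_trees_exponentially_few[OF assms dcat_left_comb[OF d1]] by blast
  have "cmod (g i \<alpha>) \<le> gbound d n k \<alpha> (Lmax n d Hc) * (C * exp (- c * real k))"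
    if k: "k \<ge> 1" and n: "n \<ge> 1" and g: "is_inverse n d Hc g" "JH_nilp n d Hc p" and i: "i < n"
      and \<alpha>: "\<alpha> \<in> mi n" "mdeg n \<alpha> = (d - 1) * k + 1" for k n Hc g i \<alpha>
  proof -
    define M where "M = {T \<in> catalan d k. has_subtree (left_comb d p) T}"
    \<comment> \<open>The singleton classes add up to the indicator of the trees containing the
      comb, so \<open>\<phi> - 1\<close> is, up to sign, the indicator of the avoiding
      trees.\<close>
    define \<phi> :: "ptree \<Rightarrow> real" where "\<phi> = (\<lambda>T. \<Sum>S\<in>(\<lambda>T. {T}) ` M. 1 * indicator S T)"
    have fin: "finite M" using d1 by (simp add: M_def)
    have "\<phi> \<in> shuffle_span d k p"
      unfolding shuffle_span_def \<phi>_def mem_Collect_eq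
      using fin singleton_shuffle_class[OF d1] by (intro exI[of _ "(\<lambda>T. {T}) ` M"] exI[of _ "\<lambda>_. 1"]) (auto simp: M_def)
    then have 1: "cmod (g i \<alpha>) \<le> gbound d n k \<alpha> (Lmax n d Hc) * norm1 d k (\<lambda>T. \<phi> T - 1)"
      using norm_inverse_nilpotent_le assms g i k \<alpha> by blast
    have \<phi>: "\<phi> T = indicator M T" for T
    proof -
      have "\<phi> T = (\<Sum>T'\<in>M. indicator {T'} T)"
        unfolding \<phi>_def by (subst sum.reindex) (auto simp: inj_on_def)
      also have "\<dots> = (\<Sum>T'\<in>M. if T' = T then 1 else 0)"
        by (intro sum.cong) (auto simp: indicator_def)
      finally show ?thesis using fin by (simp add: indicator_def)
    qed
    have "(\<Sum>T\<in>catalan d k. \<bar>\<phi> T - 1\<bar>) = (\<Sum>T\<in>catalan d k. if \<not> has_subtree (left_comb d p) T then 1 else 0)"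
      by (intro sum.cong) (auto simp: \<phi> M_def indicator_def)
    also have "\<dots> = real (card {T \<in> catalan d k. \<not> has_subtree (left_comb d p) T})"
      using d1 by (subst sum.inter_filter[symmetric]) simp_all
    finally have "norm1 d k (\<lambda>T. \<phi> T - 1) \<le> C * exp (- c * real k)"
      using few[of k] card_catalan_pos[OF d1, of k] by (simp add: norm1_def divide_le_eq)
    \<comment> \<open>Nonnegativity comes for free from the general bound, whose left-hand side is a
      norm.\<close>
    moreover have "gbound d n k \<alpha> (Lmax n d Hc) \<ge> 0"
      using norm_inverse_le[OF assms g(1) i k \<alpha>] norm_ge_zero order_trans by blast
    ultimately show ?thesis using 1 mult_left_mono order_trans by blast
  qed
  \<comment> \<open>The estimate holds for every \<open>k >= 1\<close>, so \<open>K = 1\<close> is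
    the threshold.\<close>
  then show ?thesis using C by (intro exI[of _ C] exI[of _ c] conjI exI[of _ 1]) auto
qed

theorem theorem5p4:
  fixes d :: nat
  assumes "d \<ge> 2"
  shows
  \<comment> \<open>bound (1)\<close>
  "(\<forall>n\<ge>1. \<forall>Hc g. is_inverse n d Hc g \<longrightarrow>
      (\<forall>i<n. \<forall>k\<ge>1. \<forall>\<alpha>\<in>mi n. mdeg n \<alpha> = (d - 1) * k + 1 \<longrightarrow>
         cmod (g i \<alpha>) \<le> gbound d n k \<alpha> (Lmax n d Hc)))
   \<and>
   \<comment> \<open>sharpness\<close>
   (\<forall>n\<ge>1. \<exists>Hc g. is_inverse n d Hc g \<and> Lmax n d Hc > 0 \<and>
      (\<forall>i<n. \<forall>k\<ge>1. \<forall>\<alpha>\<in>mi n. mdeg n \<alpha> = (d - 1) * k + 1 \<longrightarrow>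
         cmod (g i \<alpha>) = gbound d n k \<alpha> (Lmax n d Hc)))
   \<and>
   \<comment> \<open>nilpotent case, shuffle-class refinement\<close>
   (\<forall>n\<ge>1. \<forall>Hc g p. is_inverse n d Hc g \<and> JH_nilp n d Hc p \<longrightarrow>
      (\<forall>i<n. \<forall>k\<ge>1. \<forall>\<alpha>\<in>mi n. mdeg n \<alpha> = (d - 1) * k + 1 \<longrightarrow>
         (\<forall>\<phi>\<in>shuffle_span d k p.
            cmod (g i \<alpha>) \<le> gbound d n k \<alpha> (Lmax n d Hc) * norm1 d k (\<lambda>T. \<phi> T - 1))))
   \<and>
   \<comment> \<open>exponential improvement, constants depending only on d and p\<close>
   (\<forall>p. \<exists>C c. C > 0 \<and> c > 0 \<and> (\<exists>K. \<forall>k\<ge>K.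
      \<forall>n\<ge>1. \<forall>Hc g. is_inverse n d Hc g \<and> JH_nilp n d Hc p \<longrightarrow>
        (\<forall>i<n. \<forall>\<alpha>\<in>mi n. mdeg n \<alpha> = (d - 1) * k + 1 \<longrightarrow>
           cmod (g i \<alpha>) \<le> gbound d n k \<alpha> (Lmax n d Hc) * (C * exp (- c * real k)))))"
  by (intro conjI allI impI ballI norm_inverse_nilpotent_exp_le[OF assms] sharp_inverse[OF assms])
    (auto intro: norm_inverse_le[OF assms] norm_inverse_nilpotent_le[OF assms])

end
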